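(* Let $A=S(V,N)$ be the $N$-symmetric algebra of $V$, let $M,P$ be $A$-bimodules, and let $q\ge p\ge 0$ be such that $\nu(q-p)\ne\nu(q)-\nu(p)$ (that is, $N>2$, $p$ is odd and $q$ is even). Let $f:\bigwedge^{\nu(p)}V\to P$ be a $k$-linear map and $z=m\otimes(x_1\wedge\cdots\wedge x_{\nu(q)})\in M\otimes\bigwedge^{\nu(q)}V$, where $m\in M$ and $x_1<\cdots<x_{\nu(q)}$ belong to the ordered basis $(e_1,\ldots,e_n)$ of $V$, viewed as a Koszul $p$-cochain and a Koszul $q$-chain via the isomorphisms $\phi_r:\bigwedge^r V\to Ant_r(V^{\otimes r})$. Then the left Koszul cap product, viewed in $(P\otimes_AM)\otimes\bigwedge^{\nu(q-p)}V$, is given by $$\begin{aligned}f\underset{K}{\frown}z=-\sum_{0\le i+j\le N-2}\ \sum_{\sigma\in Sh(i,\nu(q-p),\nu(p),j)}\mathrm{sgn}(\sigma)\,\bigl(&x_{\sigma(\nu(q-p)+i+1)}\ldots x_{\sigma(\nu(q)-\nu(p)-j)}\,f(x_{\sigma(\nu(q)-\nu(p)-j+1)}\wedge\cdots\wedge x_{\sigma(\nu(q)-j)})\\&\otimes_A x_{\sigma(\nu(q)-j+1)}\ldots x_{\sigma(\nu(q))}\,m\,x_{\sigma(1)}\ldots x_{\sigma(i)}\bigr)\otimes(x_{\sigma(i+1)}\wedge\cdots\wedge x_{\sigma(\nu(q-p)+i)}),\end{aligned}$$ where the outer sum is over integers $i,j\ge0$.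
   Context: $k$ is a field, $V$ a $k$-vector space of finite dimension $n\ge 2$ with ordered basis $(e_1,\ldots,e_n)$ (with $e_1<\cdots<e_n$), and $N$ is an integer with $2\le N\le n$. Tensor symbols $\otimes$ between elements of $V$ are omitted. For $r\ge1$, $Ant_r:V^{\otimes r}\to V^{\otimes r}$ is the linear map $Ant_r(z)=\sum_{\sigma\in\Sigma_r}\mathrm{sgn}(\sigma)\,\sigma\cdot z$, where $\Sigma_r$ is the group of permutations of $\{1,\ldots,r\}$ and $\sigma\cdot(x_1\ldots x_r)=x_{\sigma^{-1}(1)}\ldots x_{\sigma^{-1}(r)}$; $Ant_0=\mathrm{Id}_k$. There is an isomorphism $\phi_r:\bigwedge^r V\to Ant_r(V^{\otimes r})$, $e_{i_1}\wedge\cdots\wedge e_{i_r}\mapsto Ant_r(e_{i_1}\ldots e_{i_r})$ for $i_1<\cdots<i_r$. The $N$-symmetric algebra is $A=S(V,N)=T(V)/(R)$ with $R=Ant_N(V^{\otimes N})$. Elements of $V$ appearing as factors in bimodules mean their images in $A$. Put $W_r=\bigcap_{i+N+j=r}V^{\otimes i}\otimes R\otimes V^{\otimes j}\subseteq V^{\otimes r}$ (so $W_r=V^{\otimes r}$ for $r<N$). Define $\nu(2p')=Np'$ and $\nu(2p'+1)=Np'+1$. For all $p$ one has $W_{\nu(p)}=Ant_{\nu(p)}(V^{\otimes\nu(p)})$, so Koszul $p$-cochains (linear maps $f:W_{\nu(p)}\to P$) are identified with linear maps $f\circ\phi_{\nu(p)}:\bigwedge^{\nu(p)}V\to P$, denoted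 by the same letter, and Koszul $q$-chains (elements of $M\otimes W_{\nu(q)}$) with elements of $M\otimes\bigwedge^{\nu(q)}V$ via $\mathrm{id}\otimes\phi_{\nu(q)}$. Left Koszul cap product: for a Koszul $p$-cochain $f:W_{\nu(p)}\to P$ and a Koszul $q$-chain written as (a sum of) $z=m\otimes x_1\ldots x_{\nu(q)}\in M\otimes W_{\nu(q)}$ with $q\ge p$, the element $f\underset{K}{\frown}z\in(P\otimes_AM)\otimes W_{\nu(q-p)}$ is defined as follows, $f$ being applied to the indicated tensor positions, using the natural inclusions $W_{\nu(q)}\subseteq V^{\otimes i}\otimes W_{\nu(q-p)}\otimes V^{\otimes l}\otimes W_{\nu(p)}\otimes V^{\otimes j}$. (1) If $p$ and $q-p$ are not both odd (so $\nu(q-p)=\nu(q)-\nu(p)$): $f\underset{K}{\frown}z=(f(x_{\nu(q-p)+1}\ldots x_{\nu(q)})\otimes_Am)\otimes x_1\ldots x_{\nu(q-p)}$. (2) If $p$ is odd and $q$ is even (so $\nu(q-p)=\nu(q)-\nu(p)-N+2$): $f\underset{K}{\frown}z=-\sum_{0\le i+j\le N-2}\bigl(x_{\nu(q-p)+i+1}\ldots x_{\nu(q)-\nu(p)-j}\,f(x_{\nu(q)-\nu(p)-j+1}\ldots x_{\nu(q)-j})\otimes_A x_{\nu(q)-j+1}\ldots x_{\nu(q)}\,m\,x_1\ldots x_i\bigr)\otimes x_{i+1}\ldots x_{\nu(q-p)+i}$, the sum being over $i,j\ge0$. $Sh(i,\nu(q-p),\nu(p),j)$ denotes the set of permutations $\sigma$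 of $\{1,\ldots,\nu(q)\}$ that are increasing on $\{i+1,\ldots,i+\nu(q-p)\}$ and increasing on $\{\nu(q)-\nu(p)-j+1,\ldots,\nu(q)-j\}$ (no condition on the other indices). *)

theory Defs
  imports
    Complex_Main
    "HOL-Library.Cardinality"
    "HOL-Algebra.Free_Abelian_Groups"
    "HOL-Algebra.Generated_Groups"
    "HOL-Algebra.Module"
    "HOL-Algebra.QuotRing"
    "HOL-Combinatorics.Permutations"
begin

section \<open>Bimodules and tensor products over a ring\<close>

text \<open>
  As for \<^typ>\<open>('a, 'b) module\<close>, the multiplicative components of the underlying ring record
  are irrelevant.
\<close>

record ('a, 'm) bimod = "('a, 'm) module" +
  rsmult :: "'m \<Rightarrow> 'a \<Rightarrow> 'm"

locale bimodule =
  fixes A :: "('a, 'c) ring_scheme" and M :: "('a, 'm, 'd) bimod_scheme"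
  assumes ring: "ring A"
    and abelian_group: "abelian_group M"
    and smult_closed: "\<And>a x. a \<in> carrier A \<Longrightarrow> x \<in> carrier M \<Longrightarrow> smult M a x \<in> carrier M"
    and smult_l_distr: "\<And>a b x. a \<in> carrier A \<Longrightarrow> b \<in> carrier A \<Longrightarrow> x \<in> carrier M \<Longrightarrow>
          smult M (a \<oplus>\<^bsub>A\<^esub> b) x = smult M a x \<oplus>\<^bsub>M\<^esub> smult M b x"
    and smult_r_distr: "\<And>a x y. a \<in> carrier A \<Longrightarrow> x \<in> carrier M \<Longrightarrow> y \<in> carrier M \<Longrightarrow>
          smult M a (x \<oplus>\<^bsub>M\<^esub> y) = smult M a x \<oplus>\<^bsub>M\<^esub> smult M a y"
    and smult_assoc: "\<And>a b x. a \<in> carrier A \<Longrightarrow> b \<in> carrier A \<Longrightarrow> x \<in> carrier M \<Longrightarrow>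
          smult M (a \<otimes>\<^bsub>A\<^esub> b) x = smult M a (smult M b x)"
    and smult_one: "\<And>x. x \<in> carrier M \<Longrightarrow> smult M \<one>\<^bsub>A\<^esub> x = x"
    and rsmult_closed: "\<And>a x. a \<in> carrier A \<Longrightarrow> x \<in> carrier M \<Longrightarrow> rsmult M x a \<in> carrier M"
    and rsmult_r_distr: "\<And>a b x. a \<in> carrier A \<Longrightarrow> b \<in> carrier A \<Longrightarrow> x \<in> carrier M \<Longrightarrow>
          rsmult M x (a \<oplus>\<^bsub>A\<^esub> b) = rsmult M x a \<oplus>\<^bsub>M\<^esub> rsmult M x b"
    and rsmult_l_distr: "\<And>a x y. a \<in> carrier A \<Longrightarrow> x \<in> carrier M \<Longrightarrow> y \<in> carrier M \<Longrightarrow>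
          rsmult M (x \<oplus>\<^bsub>M\<^esub> y) a = rsmult M x a \<oplus>\<^bsub>M\<^esub> rsmult M y a"
    and rsmult_assoc: "\<And>a b x. a \<in> carrier A \<Longrightarrow> b \<in> carrier A \<Longrightarrow> x \<in> carrier M \<Longrightarrow>
          rsmult M x (a \<otimes>\<^bsub>A\<^esub> b) = rsmult M (rsmult M x a) b"
    and rsmult_one: "\<And>x. x \<in> carrier M \<Longrightarrow> rsmult M x \<one>\<^bsub>A\<^esub> = x"
    and smult_rsmult: "\<And>a b x. a \<in> carrier A \<Longrightarrow> b \<in> carrier A \<Longrightarrow> x \<in> carrier M \<Longrightarrow>
          rsmult M (smult M a x) b = smult M a (rsmult M x b)"

definition restrict_scalars :: "('k \<Rightarrow> 'a) \<Rightarrow> ('a, 'm, 'd) bimod_scheme \<Rightarrow> ('k, 'm) bimod"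
  where "restrict_scalars h M =
    \<lparr>carrier = carrier M, monoid.mult = monoid.mult M, one = one M, zero = zero M, add = add M,
     smult = (\<lambda>c. smult M (h c)), rsmult = (\<lambda>x c. rsmult M x (h c))\<rparr>"

text \<open>
  The tensor product of \<open>X\<close> and \<open>Y\<close> over \<open>A\<close> is the free abelian group on pairs modulo
  the usual relations.  It is again an \<open>A\<close>-bimodule, \<open>a (x \<otimes> y) b = (a x) \<otimes> (y b)\<close>.
\<close>

abbreviation tensor_free :: "('a, 'x) bimod \<Rightarrow> ('a, 'y) bimod \<Rightarrow> ('x \<times> 'y \<Rightarrow>\<^sub>0 int) monoid"
  where "tensor_free X Y \<equiv> free_Abelian_group (carrier X \<times> carrier Y)"

definition tensor_rels ::
    "('a, 'c) ring_scheme \<Rightarrow> ('a, 'x) bimod \<Rightarrow> ('a, 'y) bimod \<Rightarrow> ('x \<times> 'y \<Rightarrow>\<^sub>0 int) set"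
  where "tensor_rels A X Y =
    {frag_of (x \<oplus>\<^bsub>X\<^esub> x', y) - frag_of (x, y) - frag_of (x', y) | x x' y.
       x \<in> carrier X \<and> x' \<in> carrier X \<and> y \<in> carrier Y} \<union>
    {frag_of (x, y \<oplus>\<^bsub>Y\<^esub> y') - frag_of (x, y) - frag_of (x, y') | x y y'.
       x \<in> carrier X \<and> y \<in> carrier Y \<and> y' \<in> carrier Y} \<union>
    {frag_of (rsmult X x a, y) - frag_of (x, smult Y a y) | x a y.
       x \<in> carrier X \<and> a \<in> carrier A \<and> y \<in> carrier Y}"

definition tensor_null ::
    "('a, 'c) ring_scheme \<Rightarrow> ('a, 'x) bimod \<Rightarrow> ('a, 'y) bimod \<Rightarrow> ('x \<times> 'y \<Rightarrow>\<^sub>0 int) set"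
  where "tensor_null A X Y = generate (tensor_free X Y) (tensor_rels A X Y)"

definition tensor_class ::
    "('a, 'c) ring_scheme \<Rightarrow> ('a, 'x) bimod \<Rightarrow> ('a, 'y) bimod \<Rightarrow>
     ('x \<times> 'y \<Rightarrow>\<^sub>0 int) \<Rightarrow> ('x \<times> 'y \<Rightarrow>\<^sub>0 int) set"
  where "tensor_class A X Y u = tensor_null A X Y #>\<^bsub>tensor_free X Y\<^esub> u"

definition tens ::
    "('a, 'c) ring_scheme \<Rightarrow> ('a, 'x) bimod \<Rightarrow> ('a, 'y) bimod \<Rightarrow>
     'x \<Rightarrow> 'y \<Rightarrow> ('x \<times> 'y \<Rightarrow>\<^sub>0 int) set"
  where "tens A X Y x y = tensor_class A X Y (frag_of (x, y))"

text \<open>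
  The map \<open>g \<otimes> h\<close>, from the tensor product of \<open>X\<close> and \<open>Y\<close> to that of \<open>X'\<close> and \<open>Y'\<close>.
  For \<open>g\<close>, \<open>h\<close> compatible with the relations, all members of the union below are the same coset.
\<close>

definition tensor_map ::
    "('a, 'c) ring_scheme \<Rightarrow> ('a, 'x') bimod \<Rightarrow> ('a, 'y') bimod \<Rightarrow>
     ('x \<Rightarrow> 'x') \<Rightarrow> ('y \<Rightarrow> 'y') \<Rightarrow> ('x \<times> 'y \<Rightarrow>\<^sub>0 int) set \<Rightarrow> ('x' \<times> 'y' \<Rightarrow>\<^sub>0 int) set"
  where "tensor_map A X' Y' g h Z =
    (\<Union>u\<in>Z. tensor_class A X' Y' (frag_extend (\<lambda>(x, y). frag_of (g x, h y)) u))"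

definition tensor_prod ::
    "('a, 'c) ring_scheme \<Rightarrow> ('a, 'x) bimod \<Rightarrow> ('a, 'y) bimod \<Rightarrow>
     ('a, ('x \<times> 'y \<Rightarrow>\<^sub>0 int) set) bimod"
  where "tensor_prod A X Y =
    (let Q = tensor_free X Y Mod tensor_null A X Y in
     \<lparr>carrier = carrier Q, monoid.mult = undefined, one = undefined,
      zero = one Q, add = monoid.mult Q,
      smult = (\<lambda>a. tensor_map A X Y (smult X a) id),
      rsmult = (\<lambda>Z a. tensor_map A X Y id (\<lambda>y. rsmult Y y a) Z)\<rparr>)"


section \<open>The tensor algebra\<close>

text \<open>
  Let \<open>V\<close> be a vector space over \<open>'k\<close> with ordered basis \<open>e\<close> indexed by the finite linear order
  \<open>'b\<close>; its dimension is \<open>CARD('b)\<close>.  The tensor algebra of \<open>V\<close> is realised on its basis of words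
  in the basis vectors, i.e. as the monoid algebra of the free monoid on \<open>'b\<close>.
\<close>

datatype 'b word = Word (letters: "'b list")

instantiation word :: (type) monoid_add
begin
definition zero_word :: "'a word" where "0 = Word []"
definition plus_word :: "'a word \<Rightarrow> 'a word \<Rightarrow> 'a word"
  where "u + v = Word (letters u @ letters v)"
instance by standard (simp_all add: zero_word_def plus_word_def)
end

type_synonym ('b, 'k) tensor = "'b word \<Rightarrow>\<^sub>0 'k"

definition scal :: "'k \<Rightarrow> ('b, 'k::field) tensor"
  where "scal c = Poly_Mapping.single 0 c"

definition tens_pow :: "nat \<Rightarrow> ('b, 'k::field) tensor set"
  where "tens_pow r = {a. \<forall>w \<in> Poly_Mapping.keys a. length (letters w) = r}"

definition tspan :: "('b, 'k::field) tensor set \<Rightarrow> ('b, 'k) tensor set"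
  where "tspan = Modules.module.span (\<lambda>c a. scal c * a)"

definition ordered_basis ::
    "('k::field \<Rightarrow> 'v::ab_group_add \<Rightarrow> 'v) \<Rightarrow> ('b::{finite,linorder} \<Rightarrow> 'v) \<Rightarrow> bool"
  where "ordered_basis scl e \<longleftrightarrow>
    inj e \<and> \<not> Modules.module.dependent scl (range e) \<and> Modules.module.span scl (range e) = UNIV"

text \<open>The inclusion of \<open>V\<close> into its tensor algebra, and products of vectors there.\<close>

definition vec ::
    "('k::field \<Rightarrow> 'v::ab_group_add \<Rightarrow> 'v) \<Rightarrow> ('b::{finite,linorder} \<Rightarrow> 'v) \<Rightarrow> 'v \<Rightarrow> ('b, 'k) tensor"
  where "vec scl e v =
    (\<Sum>b\<in>UNIV. Poly_Mapping.single (Word [b]) (Modules.module.representation scl (range e) v (e b)))"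

definition vprod ::
    "('k::field \<Rightarrow> 'v::ab_group_add \<Rightarrow> 'v) \<Rightarrow> ('b::{finite,linorder} \<Rightarrow> 'v) \<Rightarrow> 'v list \<Rightarrow>
     ('b, 'k) tensor"
  where "vprod scl e vs = prod_list (map (vec scl e) vs)"

text \<open>
  Positions in a tensor of degree \<open>r\<close> are numbered from 0, so the symmetric group consists of the
  permutations of \<open>{..<r}\<close>.  With \<^term>\<open>permute_list f xs ! i = xs ! f i\<close>, the place permutation
  \<open>\<sigma> (x\<^sub>1 \<dots> x\<^sub>r)\<close> uses the inverse of \<open>\<sigma>\<close>.
\<close>

definition place :: "(nat \<Rightarrow> nat) \<Rightarrow> ('b, 'k::field) tensor \<Rightarrow> ('b, 'k) tensor"
  where "place \<sigma> a = (\<Sum>w \<in> Poly_Mapping.keys a.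
    Poly_Mapping.single (Word (permute_list (inv_into UNIV \<sigma>) (letters w))) (Poly_Mapping.lookup a w))"

definition Ant :: "nat \<Rightarrow> ('b, 'k::field) tensor \<Rightarrow> ('b, 'k) tensor"
  where "Ant r a = (\<Sum>\<sigma> | \<sigma> permutes {..<r}. of_int (sign \<sigma>) * place \<sigma> a)"

definition type_ring :: "'a::ring_1 ring"
  where "type_ring = \<lparr>carrier = UNIV, monoid.mult = (*), one = 1, zero = 0, add = (+)\<rparr>"

definition tensor_bimod :: "('k::field, ('b, 'k) tensor) bimod"
  where "tensor_bimod = \<lparr>carrier = UNIV, monoid.mult = (*), one = 1, zero = 0, add = (+),
    smult = (\<lambda>c a. scal c * a), rsmult = (\<lambda>a c. a * scal c)\<rparr>"


section \<open>The \<open>N\<close>-symmetric algebra\<close>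

definition sym_rels :: "nat \<Rightarrow> ('b, 'k::field) tensor set"
  where "sym_rels N = Ant N ` tens_pow N"

definition sym_alg :: "nat \<Rightarrow> ('b, 'k::field) tensor set ring"
  where "sym_alg N = type_ring Quot (Idl\<^bsub>type_ring\<^esub> sym_rels N)"

definition sym_proj :: "nat \<Rightarrow> ('b, 'k::field) tensor \<Rightarrow> ('b, 'k) tensor set"
  where "sym_proj N a = (Idl\<^bsub>type_ring\<^esub> sym_rels N) +>\<^bsub>type_ring\<^esub> a"

text \<open>Bimodules over the \<open>k\<close>-algebra \<open>A\<close>: the two actions of \<open>k\<close> coincide.\<close>

definition sym_bimodule :: "nat \<Rightarrow> (('b, 'k::field) tensor set, 'm) bimod \<Rightarrow> bool"
  where "sym_bimodule N M \<longleftrightarrow> bimodule (sym_alg N) M \<and>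
    (\<forall>c. \<forall>x \<in> carrier M. smult M (sym_proj N (scal c)) x = rsmult M x (sym_proj N (scal c)))"

abbreviation over_k :: "nat \<Rightarrow> (('b, 'k::field) tensor set, 'm) bimod \<Rightarrow> ('k, 'm) bimod"
  where "over_k N \<equiv> restrict_scalars (\<lambda>c. sym_proj N (scal c))"


section \<open>The exterior algebra\<close>

definition ext_null :: "('b, 'k::field) tensor set"
  where "ext_null = Idl\<^bsub>type_ring\<^esub> {v * v | v. v \<in> tens_pow 1}"

definition ext_alg :: "('b, 'k::field) tensor set ring"
  where "ext_alg = type_ring Quot ext_null"

definition ext_proj :: "('b, 'k::field) tensor \<Rightarrow> ('b, 'k) tensor set"
  where "ext_proj a = ext_null +>\<^bsub>type_ring\<^esub> a"

definition ext_pow :: "nat \<Rightarrow> ('k::field, ('b, 'k) tensor set) bimod"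
  where "ext_pow r = \<lparr>carrier = ext_proj ` tens_pow r,
    monoid.mult = undefined, one = undefined, zero = zero ext_alg, add = add ext_alg,
    smult = (\<lambda>c X. ext_proj (scal c) \<otimes>\<^bsub>ext_alg\<^esub> X),
    rsmult = (\<lambda>X c. X \<otimes>\<^bsub>ext_alg\<^esub> ext_proj (scal c))\<rparr>"

definition wedge ::
    "('k::field \<Rightarrow> 'v::ab_group_add \<Rightarrow> 'v) \<Rightarrow> ('b::{finite,linorder} \<Rightarrow> 'v) \<Rightarrow> 'v list \<Rightarrow>
     ('b, 'k) tensor set"
  where "wedge scl e vs = ext_proj (vprod scl e vs)"

text \<open>
  \<open>\<phi>\<^sub>r\<close> is induced by \<open>Ant\<^sub>r\<close>: it sends the class of a tensor \<open>a\<close> of degree \<open>r\<close> to \<open>Ant\<^sub>r a\<close>.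
\<close>

definition ext_phi :: "nat \<Rightarrow> ('b, 'k::field) tensor set \<Rightarrow> ('b, 'k) tensor"
  where "ext_phi r X = the_elem (Ant r ` (X \<inter> tens_pow r))"


section \<open>Koszul chains, cochains and the left cap product\<close>

definition nu :: "nat \<Rightarrow> nat \<Rightarrow> nat"
  where "nu N p = (if even p then N * (p div 2) else N * (p div 2) + 1)"

definition W :: "nat \<Rightarrow> nat \<Rightarrow> ('b, 'k::field) tensor set"
  where "W N r = tens_pow r \<inter> (\<Inter>(i, j) \<in> {(i, j). i + N + j = r}.
    tspan {u * \<rho> * v | u \<rho> v. u \<in> tens_pow i \<and> \<rho> \<in> sym_rels N \<and> v \<in> tens_pow j})"

text \<open>
  The tensor product over \<open>k\<close> of an \<open>A\<close>-bimodule with \<open>T(V)\<close>.  As \<open>k\<close> is a field, it contains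
  \<open>X \<otimes> W\<^sub>r\<close> for all \<open>r\<close>; Koszul chains are regarded as its elements.
\<close>

definition chain_space :: "nat \<Rightarrow> (('b, 'k::field) tensor set, 'm) bimod \<Rightarrow>
    ('k, ('m \<times> ('b, 'k) tensor \<Rightarrow>\<^sub>0 int) set) bimod"
  where "chain_space N X = tensor_prod type_ring (over_k N X) tensor_bimod"

definition chain_tens :: "nat \<Rightarrow> (('b, 'k::field) tensor set, 'm) bimod \<Rightarrow>
    'm \<Rightarrow> ('b, 'k) tensor \<Rightarrow> ('m \<times> ('b, 'k) tensor \<Rightarrow>\<^sub>0 int) set"
  where "chain_tens N X x w = tens type_ring (over_k N X) tensor_bimod x w"

text \<open>
  Write a chain \<open>z\<close> as a finite sum of terms \<open>m \<otimes> u y v w s\<close>, where \<open>u\<close>, \<open>v\<close>, \<open>s\<close> have degrees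
  \<open>i\<close>, \<open>l\<close>, \<open>j\<close> and \<open>y \<in> W\<^sub>a\<close>, \<open>w \<in> W\<^sub>b\<close>.  The set \<open>cap_graph\<close> consists of all pairs of such
  a \<open>z\<close> and the sum of the corresponding terms \<open>(v f(w) \<otimes>\<^sub>A s m u) \<otimes> y\<close>; \<open>cap_term\<close> is the
  resulting function.
\<close>

inductive_set cap_graph ::
    "nat \<Rightarrow> (('b, 'k::field) tensor set, 'm) bimod \<Rightarrow> (('b, 'k) tensor set, 'p) bimod \<Rightarrow>
     (('b, 'k) tensor \<Rightarrow> 'p) \<Rightarrow> nat \<Rightarrow> nat \<Rightarrow> nat \<Rightarrow> nat \<Rightarrow> nat \<Rightarrow>
     (('m \<times> ('b, 'k) tensor \<Rightarrow>\<^sub>0 int) set \<times>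
      (('p \<times> 'm \<Rightarrow>\<^sub>0 int) set \<times> ('b, 'k) tensor \<Rightarrow>\<^sub>0 int) set) set"
  for N :: nat and M :: "(('b, 'k::field) tensor set, 'm) bimod"
    and P :: "(('b, 'k) tensor set, 'p) bimod" and f :: "('b, 'k) tensor \<Rightarrow> 'p"
    and i a l b j :: nat
  where
    zero: "(\<zero>\<^bsub>chain_space N M\<^esub>, \<zero>\<^bsub>chain_space N (tensor_prod (sym_alg N) P M)\<^esub>)
             \<in> cap_graph N M P f i a l b j"
  | add: "(z, t) \<in> cap_graph N M P f i a l b j \<Longrightarrow> m \<in> carrier M \<Longrightarrow>
          u \<in> tens_pow i \<Longrightarrow> y \<in> W N a \<Longrightarrow> v \<in> tens_pow l \<Longrightarrow> w \<in> W N b \<Longrightarrow> s \<in> tens_pow j \<Longrightarrow>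
          (z \<oplus>\<^bsub>chain_space N M\<^esub> chain_tens N M m (u * y * v * w * s),
           t \<oplus>\<^bsub>chain_space N (tensor_prod (sym_alg N) P M)\<^esub>
             chain_tens N (tensor_prod (sym_alg N) P M)
               (tens (sym_alg N) P M
                 (smult P (sym_proj N v) (f w))
                 (rsmult M (smult M (sym_proj N s) m) (sym_proj N u)))
               y)
          \<in> cap_graph N M P f i a l b j"

definition cap_term ::
    "nat \<Rightarrow> (('b, 'k::field) tensor set, 'm) bimod \<Rightarrow> (('b, 'k) tensor set, 'p) bimod \<Rightarrow>
     (('b, 'k) tensor \<Rightarrow> 'p) \<Rightarrow> nat \<Rightarrow> nat \<Rightarrow> nat \<Rightarrow> nat \<Rightarrow> nat \<Rightarrow>
     ('m \<times> ('b, 'k) tensor \<Rightarrow>\<^sub>0 int) set \<Rightarrow>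
     (('p \<times> 'm \<Rightarrow>\<^sub>0 int) set \<times> ('b, 'k) tensor \<Rightarrow>\<^sub>0 int) set"
  where "cap_term N M P f i a l b j z = (THE t. (z, t) \<in> cap_graph N M P f i a l b j)"

definition koszul_cap ::
    "nat \<Rightarrow> (('b, 'k::field) tensor set, 'm) bimod \<Rightarrow> (('b, 'k) tensor set, 'p) bimod \<Rightarrow>
     nat \<Rightarrow> nat \<Rightarrow> (('b, 'k) tensor \<Rightarrow> 'p) \<Rightarrow> ('m \<times> ('b, 'k) tensor \<Rightarrow>\<^sub>0 int) set \<Rightarrow>
     (('p \<times> 'm \<Rightarrow>\<^sub>0 int) set \<times> ('b, 'k) tensor \<Rightarrow>\<^sub>0 int) set"
  where "koszul_cap N M P p q f z =
    (let C = chain_space N (tensor_prod (sym_alg N) P M); a = nu N (q - p); b = nu N p in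
     if odd p \<and> even q
     then \<ominus>\<^bsub>C\<^esub> finsum C (\<lambda>(i, j). cap_term N M P f i a (N - 2 - i - j) b j z)
                 {(i, j). i + j \<le> N - 2}
     else cap_term N M P f 0 a 0 b 0 z)"

definition klinear :: "('k, 'x) bimod \<Rightarrow> ('k, 'y) bimod \<Rightarrow> ('x \<Rightarrow> 'y) \<Rightarrow> bool"
  where "klinear X Y f \<longleftrightarrow> f \<in> carrier X \<rightarrow> carrier Y \<and>
    (\<forall>x \<in> carrier X. \<forall>x' \<in> carrier X. f (x \<oplus>\<^bsub>X\<^esub> x') = f x \<oplus>\<^bsub>Y\<^esub> f x') \<and>
    (\<forall>c. \<forall>x \<in> carrier X. f (smult X c x) = smult Y c (f x))"

text \<open>
  The identifications along \<open>\<phi>\<^sub>r\<close>: a linear map \<open>f\<close> on the exterior power gives the cochain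
  \<open>f \<circ> \<phi>\<^sub>r\<^sup>-\<^sup>1\<close> on \<open>W\<^sub>r = Ant\<^sub>r(V\<^sup>\<otimes>\<^sup>r)\<close>, and an element \<open>z\<close> of \<open>X \<otimes> \<Lambda>\<^sup>r V\<close> gives the chain
  \<open>(id \<otimes> \<phi>\<^sub>r) z\<close>.
\<close>

definition cochain_of_ext ::
    "nat \<Rightarrow> (('b, 'k::field) tensor set \<Rightarrow> 'p) \<Rightarrow> ('b, 'k) tensor \<Rightarrow> 'p"
  where "cochain_of_ext r f w = f (inv_into (carrier (ext_pow r)) (ext_phi r) w)"

definition ext_chains :: "nat \<Rightarrow> (('b, 'k::field) tensor set, 'm) bimod \<Rightarrow> nat \<Rightarrow>
    ('k, ('m \<times> ('b, 'k) tensor set \<Rightarrow>\<^sub>0 int) set) bimod"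
  where "ext_chains N X r = tensor_prod type_ring (over_k N X) (ext_pow r)"

definition ext_tens :: "nat \<Rightarrow> (('b, 'k::field) tensor set, 'm) bimod \<Rightarrow> nat \<Rightarrow>
    'm \<Rightarrow> ('b, 'k) tensor set \<Rightarrow> ('m \<times> ('b, 'k) tensor set \<Rightarrow>\<^sub>0 int) set"
  where "ext_tens N X r x Y = tens type_ring (over_k N X) (ext_pow r) x Y"

definition chain_of_ext :: "nat \<Rightarrow> (('b, 'k::field) tensor set, 'm) bimod \<Rightarrow> nat \<Rightarrow>
    ('m \<times> ('b, 'k) tensor set \<Rightarrow>\<^sub>0 int) set \<Rightarrow> ('m \<times> ('b, 'k) tensor \<Rightarrow>\<^sub>0 int) set"
  where "chain_of_ext N X r = tensor_map type_ring (over_k N X) tensor_bimod id (ext_phi r)"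

text \<open>
  With positions numbered from 0, the set \<open>Sh(i, a, b, j)\<close> of permutations of \<open>{..<n}\<close> (where
  \<open>n = \<nu>(q)\<close>, \<open>a = \<nu>(q-p)\<close>, \<open>b = \<nu>(p)\<close>); positions outside the two blocks are unconstrained.
\<close>

definition Sh :: "nat \<Rightarrow> nat \<Rightarrow> nat \<Rightarrow> nat \<Rightarrow> nat \<Rightarrow> (nat \<Rightarrow> nat) set"
  where "Sh n i a b j = {\<sigma>. \<sigma> permutes {..<n} \<and>
    strict_mono_on {i..<i + a} \<sigma> \<and> strict_mono_on {n - b - j..<n - j} \<sigma>}"

end

theory Submission
  imports Defs
begin

text \<open>
  Under \<open>\<phi>\<close> the chain \<open>m \<otimes> (x\<^sub>1 \<and> \<dots> \<and> x\<^sub>n)\<close> becomes \<open>m \<otimes> Ant\<^sub>n(x\<^sub>1 \<dots> x\<^sub>n)\<close>.  The defining formula of the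
  cap product cuts a tensor of degree \<open>n\<close> into consecutive pieces \<open>u y v w s\<close> of degrees
  \<open>i, a, l, b, j\<close>, where \<open>y\<close> stays in the chain and \<open>f\<close> is applied to \<open>w\<close>.  Every permutation of
  the \<open>n\<close> positions is uniquely a permutation \<open>\<sigma>\<close> that increases on the two blocks belonging to \<open>y\<close>
  and \<open>w\<close>, followed by permutations of these blocks.  Summing over the latter turns the two blocks
  into \<open>Ant\<^sub>a\<close> and \<open>Ant\<^sub>b\<close> of words, that is, into images under \<open>\<phi>\<close> of wedge products, and leaves
  a signed sum over \<open>\<sigma> \<in> Sh(i, a, b, j)\<close> (lemma \<open>Ant_shuffle\<close>).  This is the formula, once two points
  are settled.

  First, the cap product must not depend on the way in which the chain is written as a sum of terms
  \<open>m \<otimes> u y v w s\<close>.  The cochain \<open>f\<close> is given on \<open>W\<^sub>b\<close> only, but it extends to a linear map \<open>F\<close> on all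
  tensors: evaluate \<open>f\<close> on the part of the tensor supported on strictly increasing words.  With \<open>F\<close>
  in place of \<open>f\<close> each word has just one cut into pieces of the given lengths, so the formula defines
  an additive map on all of \<open>M \<otimes> T(V)\<close>.  By multilinearity it agrees with the prescribed value on every
  product \<open>u y v w s\<close> (lemmas \<open>cut_null\<close>, \<open>cut_product\<close> and \<open>cap_term_eq\<close>).

  Secondly, \<open>F\<close> agrees with \<open>f\<close> on \<open>W\<^sub>b\<close>, and the tensors \<open>Ant\<^sub>a\<close>, \<open>Ant\<^sub>b\<close> above lie in \<open>W\<^sub>a\<close>, \<open>W\<^sub>b\<close>.
  Elements of \<open>W\<^sub>r\<close> with \<open>r \<ge> N\<close> are alternating in each pair of neighbouring positions, and an
  alternating tensor is the antisymmetrisation of its strictly increasing part (lemmas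
  \<open>W_alternating\<close>, \<open>W_imp_Ant\<close>, \<open>cochain_of_ext_eq\<close>); the converse inclusion is the shuffle
  decomposition with a single block of length \<open>N\<close> (lemma \<open>Ant_in_W\<close>).

  No step divides by an integer, so the characteristic of \<open>k\<close> is arbitrary; accordingly "alternating"
  includes the vanishing on words with two equal neighbouring letters.
\<close>
section \<open>Coefficients of tensors\<close>

abbreviation wterm :: "'b list \<Rightarrow> 'k::field \<Rightarrow> ('b, 'k) tensor"
  where "wterm xs c \<equiv> Poly_Mapping.single (Word xs) c"

abbreviation cf :: "('b, 'k::field) tensor \<Rightarrow> 'b list \<Rightarrow> 'k"
  where "cf a xs \<equiv> Poly_Mapping.lookup a (Word xs)"

lemma tensor_eqI:
  assumes "\<And>xs. cf a xs = cf b xs"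
  shows "a = b"
proof (rule poly_mapping_eqI)
  fix w show "Poly_Mapping.lookup a w = Poly_Mapping.lookup b w"
    using assms[of "letters w"] by simp
qed

lemma wterm_mult: "wterm xs c * wterm ys d = wterm (xs @ ys) (c * d)"
  by (simp add: mult_single plus_word_def)

lemma scal_wterm: "scal c = wterm [] c"
  by (simp add: scal_def zero_word_def)

lemma one_wterm: "(1 :: ('b, 'k::field) tensor) = wterm [] 1"
  by (metis single_one zero_word_def)

lemma of_int_wterm: "(of_int k :: ('b, 'k::field) tensor) = wterm [] (of_int k)"
  by (metis single_of_int zero_word_def)

lemma tensor_expand: "a = (\<Sum>w\<in>Poly_Mapping.keys a. Poly_Mapping.single w (Poly_Mapping.lookup a w))"
proof (rule poly_mapping_eqI)
  fix v
  show "Poly_Mapping.lookup a v = Poly_Mapping.lookup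
          (\<Sum>w\<in>Poly_Mapping.keys a. Poly_Mapping.single w (Poly_Mapping.lookup a w)) v"
    by (simp add: lookup_sum lookup_single when_def in_keys_iff)
qed

lemma tensor_induct [case_names zero wterm add]:
  assumes zero: "P 0" and wterm: "\<And>xs c. P (wterm xs c)"
    and add: "\<And>a b. P a \<Longrightarrow> P b \<Longrightarrow> P (a + b)"
  shows "P (a :: ('b, 'k::field) tensor)"
proof -
  have "P (\<Sum>w\<in>K. Poly_Mapping.single w (Poly_Mapping.lookup a w))" if "finite K" for K
    using that
  proof (induction K)
    case (insert w K)
    then show ?case using wterm[of "letters w"] by (auto intro: add)
  qed (simp add: zero)
  then show ?thesis by (subst tensor_expand) simp
qed

lemma tens_pow_cf: "a \<in> tens_pow r \<longleftrightarrow> (\<forall>xs. length xs \<noteq> r \<longrightarrow> cf a xs = 0)"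
proof
  assume "a \<in> tens_pow r"
  then show "\<forall>xs. length xs \<noteq> r \<longrightarrow> cf a xs = 0"
    unfolding tens_pow_def by (metis (mono_tags, lifting) in_keys_iff mem_Collect_eq word.sel)
next
  assume *: "\<forall>xs. length xs \<noteq> r \<longrightarrow> cf a xs = 0"
  have "length (letters w) = r" if "w \<in> Poly_Mapping.keys a" for w
  proof (rule ccontr)
    assume "length (letters w) \<noteq> r"
    with * have "cf a (letters w) = 0" by blast
    with that show False by (simp add: in_keys_iff)
  qed
  then show "a \<in> tens_pow r" by (simp add: tens_pow_def)
qed

lemma tens_pow_eqI:
  assumes "a \<in> tens_pow r" "b \<in> tens_pow r" "\<And>xs. length xs = r \<Longrightarrow> cf a xs = cf b xs"
  shows "a = b"
  using assms by (intro tensor_eqI) (metis tens_pow_cf)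

lemma tens_pow_zero [simp]: "0 \<in> tens_pow r"
  and tens_pow_wterm: "length xs = r \<Longrightarrow> wterm xs c \<in> tens_pow r"
  and tens_pow_add: "a \<in> tens_pow r \<Longrightarrow> b \<in> tens_pow r \<Longrightarrow> a + b \<in> tens_pow r"
  and tens_pow_uminus: "a \<in> tens_pow r \<Longrightarrow> - a \<in> tens_pow r"
  by (auto simp: tens_pow_cf lookup_add lookup_single when_def)

lemma tens_pow_sum: "(\<And>i. i \<in> I \<Longrightarrow> g i \<in> tens_pow r) \<Longrightarrow> sum g I \<in> tens_pow r"
  by (auto simp: tens_pow_cf lookup_sum)

lemma tens_pow_induct [consumes 1, case_names zero wterm add]:
  assumes a: "a \<in> tens_pow r" and zero: "P 0"
    and wterm: "\<And>xs c. length xs = r \<Longrightarrow> P (wterm xs c)"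
    and add: "\<And>a b. a \<in> tens_pow r \<Longrightarrow> b \<in> tens_pow r \<Longrightarrow> P a \<Longrightarrow> P b \<Longrightarrow> P (a + b)"
  shows "P (a :: ('b, 'k::field) tensor)"
proof -
  have "(\<Sum>w\<in>K. Poly_Mapping.single w (Poly_Mapping.lookup a w)) \<in> tens_pow r \<and>
        P (\<Sum>w\<in>K. Poly_Mapping.single w (Poly_Mapping.lookup a w))"
    if "finite K" "K \<subseteq> Poly_Mapping.keys a" for K
    using that
  proof (induction K)
    case (insert w K)
    then have "length (letters w) = r" using a by (auto simp: tens_pow_def)
    with insert wterm[of "letters w"] show ?case
      using tens_pow_wterm[of "letters w" r] by (auto intro!: add tens_pow_add)
  qed (simp add: zero)
  then show ?thesis by (subst tensor_expand) simp
qed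

text \<open>
  Words form a free monoid, so in a product whose left factor is homogeneous each word can be cut in
  one way only; the convolution formula for the product has a single term.
\<close>

lemma cf_mult:
  assumes "u \<in> tens_pow i"
  shows "cf (u * v) xs = cf u (take i xs) * cf v (drop i xs)"
  using assms
proof (induction u rule: tens_pow_induct)
  case (wterm ys c)
  show ?case
  proof (induction v rule: tensor_induct)
    case (wterm zs d)
    have "ys @ zs = xs \<longleftrightarrow> ys = take i xs \<and> zs = drop i xs"
      using \<open>length ys = i\<close> by (metis append_eq_conv_conj)
    then show ?case by (auto simp: wterm_mult lookup_single when_def)
  qed (simp_all add: distrib_left lookup_add)
qed (simp_all add: distrib_right lookup_add)

lemma scal_tens_pow: "scal c \<in> tens_pow 0"
  by (simp add: scal_wterm tens_pow_wterm)

lemma of_int_tens_pow: "of_int k \<in> tens_pow 0"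
  by (simp add: of_int_wterm tens_pow_wterm)

lemma cf_scal_mult: "cf (scal c * a) xs = c * cf a xs"
  by (simp add: cf_mult[OF scal_tens_pow]) (simp add: scal_wterm)

lemma cf_of_int_mult: "cf (of_int k * a) xs = of_int k * cf a xs"
  by (simp add: cf_mult[OF of_int_tens_pow]) (simp add: of_int_wterm)

lemma tens_pow_scal_mult: "a \<in> tens_pow r \<Longrightarrow> scal c * a \<in> tens_pow r"
  by (simp add: tens_pow_cf cf_scal_mult)

lemma scal_commute: "scal c * a = a * scal c"
proof (induction a rule: tensor_induct)
qed (simp_all add: distrib_left distrib_right scal_wterm wterm_mult mult.commute)

lemma scal_add: "scal (c + d) = scal c + scal d"
  and scal_mult: "scal (c * d) = scal c * scal d"
  and scal_one: "scal 1 = 1"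
  by (simp_all add: scal_def single_add mult_single)

interpretation tensor_module: Modules.module "\<lambda>c (a :: ('b, 'k::field) tensor). scal c * a"
  by unfold_locales (simp_all add: distrib_left distrib_right scal_add scal_mult scal_one mult.assoc)

lemma vec_basis:
  assumes "vector_space scl" "ordered_basis scl e"
  shows "vec scl e (e b) = wterm [b] 1"
proof -
  interpret vector_space scl by fact
  have ind: "independent (range e)" and inj: "inj e"
    using assms(2) by (auto simp: ordered_basis_def)
  have "vec scl e (e b) = (\<Sum>b'\<in>UNIV. if b' = b then wterm [b] 1 else 0)"
    unfolding vec_def
    by (intro sum.cong) (auto simp: representation_basis[OF ind] inj_eq[OF inj])
  then show ?thesis by simp
qed

lemma vprod_basis:
  assumes "vector_space scl" "ordered_basis scl e"
  shows "vprod scl e (map e bs) = wterm bs 1"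
proof (induction bs)
  case (Cons b bs)
  then show ?case
    by (simp add: vprod_def vec_basis[OF assms] wterm_mult)
qed (simp add: vprod_def one_wterm)

section \<open>Antisymmetrisation\<close>

lemma permute_list_inverse:
  assumes "\<sigma> permutes {..<length xs}"
  shows "permute_list \<sigma> (permute_list (inv_into UNIV \<sigma>) xs) = xs"
    "permute_list (inv_into UNIV \<sigma>) (permute_list \<sigma> xs) = xs"
  using assms permutes_inv[OF assms]
  by (simp_all flip: permute_list_compose add: permutes_inv_o[OF assms])

lemma cf_place:
  assumes "length xs = r" "\<sigma> permutes {..<r}"
  shows "cf (place \<sigma> a) xs = cf a (permute_list \<sigma> xs)"
proof -
  have "Word (permute_list (inv_into UNIV \<sigma>) (letters w)) = Word xs \<longleftrightarrow> w = Word (permute_list \<sigma> xs)" for w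
  proof
    assume eq: "Word (permute_list (inv_into UNIV \<sigma>) (letters w)) = Word xs"
    then have "length (letters w) = r" using assms(1) by (metis length_permute_list word.inject)
    then show "w = Word (permute_list \<sigma> xs)"
      using eq assms permute_list_inverse(1)[of \<sigma> "letters w"]
      by (metis word.collapse word.inject)
  qed (use assms permute_list_inverse(2)[of \<sigma> xs] in auto)
  then show ?thesis
    by (simp add: place_def lookup_sum lookup_single when_def in_keys_iff)
qed

lemma cf_Ant:
  assumes "length xs = r"
  shows "cf (Ant r a) xs =
    (\<Sum>\<sigma> | \<sigma> permutes {..<r}. of_int (sign \<sigma>) * cf a (permute_list \<sigma> xs))"
  by (simp add: Ant_def lookup_sum cf_of_int_mult cf_place[OF assms])

lemma Ant_tens_pow:
  assumes "a \<in> tens_pow r"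
  shows "Ant r a \<in> tens_pow r"
proof -
  have "place \<sigma> a \<in> tens_pow r" for \<sigma>
    using assms unfolding place_def
    by (intro tens_pow_sum tens_pow_wterm) (simp add: tens_pow_def)
  then show ?thesis
    unfolding Ant_def by (intro tens_pow_sum) (simp add: tens_pow_cf cf_of_int_mult)
qed

lemma Ant_add:
  assumes "a \<in> tens_pow r" "b \<in> tens_pow r"
  shows "Ant r (a + b) = Ant r a + Ant r b"
  using assms
  by (intro tens_pow_eqI[of _ r])
    (auto intro!: Ant_tens_pow tens_pow_add simp: cf_Ant lookup_add distrib_left sum.distrib)

lemma Ant_scal:
  assumes "a \<in> tens_pow r"
  shows "Ant r (scal c * a) = scal c * Ant r a"
  using assms
  by (intro tens_pow_eqI[of _ r])
    (auto intro!: Ant_tens_pow tens_pow_scal_mult simp: cf_Ant cf_scal_mult sum_distrib_left algebra_simps)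

lemma Ant_zero: "Ant r 0 = 0"
  by (simp add: Ant_def place_def)

lemma Ant_wterm:
  "Ant (length xs) (wterm xs c) = (\<Sum>\<sigma> | \<sigma> permutes {..<length xs}.
     wterm (permute_list \<sigma> xs) (of_int (sign \<sigma>) * c))"
proof -
  have "Ant (length xs) (wterm xs c) = (\<Sum>\<sigma> | \<sigma> permutes {..<length xs}.
     wterm (permute_list (inv_into UNIV \<sigma>) xs) (of_int (sign \<sigma>) * c))"
    by (cases "c = 0") (simp_all add: Ant_def place_def of_int_wterm wterm_mult)
  also have "\<dots> = (\<Sum>\<sigma> | \<sigma> permutes {..<length xs}.
     wterm (permute_list \<sigma> xs) (of_int (sign \<sigma>) * c))"
    by (rule sum.reindex_bij_witness[where i = "inv_into UNIV" and j = "inv_into UNIV"])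
      (auto simp: permutes_inv permutes_inv_inv sign_inverse permutes_imp_permutation[OF finite_lessThan])
  finally show ?thesis .
qed

text \<open>
  Only neighbouring positions are mentioned, which is what membership in \<open>W\<close> gives directly.  The
  first clause does not follow from the second in characteristic 2.
\<close>

definition alternating :: "('b, 'k::field) tensor \<Rightarrow> bool"
  where "alternating a \<longleftrightarrow> (\<forall>u x v. cf a (u @ [x, x] @ v) = 0) \<and>
    (\<forall>u x y v. cf a (u @ [x, y] @ v) = - cf a (u @ [y, x] @ v))"

lemma permute_list_swap:
  "permute_list (transpose (length u) (Suc (length u))) (u @ [x, y] @ v) = u @ [y, x] @ v"
proof (rule nth_equalityI)
  fix i assume "i < length (permute_list (transpose (length u) (Suc (length u))) (u @ [x, y] @ v))"
  then have i: "i < length u + 2 + length v" by simp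
  consider "i < length u" | "i = length u" | "i = Suc (length u)" | j where "i = length u + 2 + j"
    by (metis Suc_lessI add_2_eq_Suc' less_imp_Suc_add linorder_less_linear plus_nat.simps(2))
  moreover have "permute_list (transpose (length u) (Suc (length u))) (u @ [x, y] @ v) ! i =
    (u @ [x, y] @ v) ! transpose (length u) (Suc (length u)) i"
    using i by (simp add: permute_list_def del: upt_Suc)
  ultimately show "permute_list (transpose (length u) (Suc (length u))) (u @ [x, y] @ v) ! i =
    (u @ [y, x] @ v) ! i"
    by cases (auto simp: nth_append transpose_def)
qed simp

text \<open>
  Composition with a transposition exchanges the even and the odd permutations, so the terms cancel in
  pairs.  In characteristic 2 it would not suffice that the sum equals its own negative.
\<close>

lemma signed_sum_cancel:
  fixes h :: "(nat \<Rightarrow> nat) \<Rightarrow> 'k::field"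
  assumes "finite S" "i \<in> S" "j \<in> S" "i \<noteq> j"
    and T: "\<And>\<sigma>. \<sigma> permutes S \<Longrightarrow> T \<sigma> = \<sigma> \<circ> transpose i j \<or> T \<sigma> = transpose i j \<circ> \<sigma>"
    and TT: "\<And>\<sigma>. T (T \<sigma>) = \<sigma>"
    and h: "\<And>\<sigma>. \<sigma> permutes S \<Longrightarrow> h (T \<sigma>) = h \<sigma>"
  shows "(\<Sum>\<sigma> | \<sigma> permutes S. of_int (sign \<sigma>) * h \<sigma>) = 0"
proof -
  have perm: "T \<sigma> permutes S" if "\<sigma> permutes S" for \<sigma>
    using T[OF that] assms(2,3) that permutes_compose permutes_swap_id by metis
  have sgn: "sign (T \<sigma>) = - sign \<sigma>" if "\<sigma> permutes S" for \<sigma>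
    using T[OF that] permutes_imp_permutation[OF assms(1) that] assms(4)
    by (auto simp: sign_compose sign_swap_id permutation_swap_id)
  have ev: "evenperm (T \<sigma>) \<longleftrightarrow> \<not> evenperm \<sigma>" if "\<sigma> permutes S" for \<sigma>
    using sgn[OF that] by (auto simp: sign_def split: if_splits)
  have fin: "finite {\<sigma>. \<sigma> permutes S}" using assms(1) by (rule finite_permutations)
  have "(\<Sum>\<sigma> | \<sigma> permutes S. of_int (sign \<sigma>) * h \<sigma>) =
    (\<Sum>\<sigma> \<in> {\<sigma>. \<sigma> permutes S} \<inter> {\<sigma>. evenperm \<sigma>}. of_int (sign \<sigma>) * h \<sigma>) +
    (\<Sum>\<sigma> \<in> {\<sigma>. \<sigma> permutes S} - {\<sigma>. evenperm \<sigma>}. of_int (sign \<sigma>) * h \<sigma>)"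
    by (rule sum.Int_Diff[OF fin])
  also have "(\<Sum>\<sigma> \<in> {\<sigma>. \<sigma> permutes S} \<inter> {\<sigma>. evenperm \<sigma>}. of_int (sign \<sigma>) * h \<sigma>) =
    (\<Sum>\<sigma> \<in> {\<sigma>. \<sigma> permutes S} - {\<sigma>. evenperm \<sigma>}. - (of_int (sign \<sigma>) * h \<sigma>))"
    by (rule sum.reindex_bij_witness[where i = T and j = T])
      (auto simp: TT perm ev sgn h)
  finally show ?thesis by (simp add: sum_negf)
qed

lemma transpose_comp_comp: "transpose i j \<circ> (transpose i j \<circ> \<sigma>) = \<sigma>" "\<sigma> \<circ> transpose i j \<circ> transpose i j = \<sigma>"
  by (simp_all add: fun_eq_iff)

lemma alternating_Ant:
  assumes "a \<in> tens_pow r"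
  shows "alternating (Ant r a)"
proof -
  have zero: "cf (Ant r a) (u @ [x, y] @ v) = 0" if "length (u @ [x, y] @ v) \<noteq> r" for u x y v
    using Ant_tens_pow[OF assms] that unfolding tens_pow_cf by blast
  have 1: "cf (Ant r a) (u @ [x, x] @ v) = 0" if len: "length (u @ [x, x] @ v) = r" for u x v
    unfolding cf_Ant[OF len]
  proof (rule signed_sum_cancel[where T = "\<lambda>\<sigma>. transpose (length u) (Suc (length u)) \<circ> \<sigma>" and i = "length u" and j = "Suc (length u)"])
    fix \<sigma> assume "\<sigma> permutes {..<r}"
    with len show "cf a (permute_list (transpose (length u) (Suc (length u)) \<circ> \<sigma>) (u @ [x, x] @ v)) =
          cf a (permute_list \<sigma> (u @ [x, x] @ v))"
      by (subst permute_list_compose) (auto simp only: permute_list_swap)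
  qed (use len in \<open>auto simp: transpose_comp_comp\<close>)
  have 2: "cf (Ant r a) (u @ [x, y] @ v) = - cf (Ant r a) (u @ [y, x] @ v)"
    if len: "length (u @ [x, y] @ v) = r" for u x y v
  proof -
    let ?t = "transpose (length u) (Suc (length u))"
    have t: "?t permutes {..<r}" using len by (intro permutes_swap_id) auto
    have len': "length (u @ [y, x] @ v) = r" using len by simp
    have "cf (Ant r a) (u @ [x, y] @ v) = (\<Sum>\<sigma> | \<sigma> permutes {..<r}.
        of_int (sign (?t \<circ> \<sigma>)) * cf a (permute_list (?t \<circ> \<sigma>) (u @ [x, y] @ v)))"
      unfolding cf_Ant[OF len]
      by (rule sum.reindex_bij_witness[where i = "\<lambda>\<sigma>. ?t \<circ> \<sigma>" and j = "\<lambda>\<sigma>. ?t \<circ> \<sigma>"])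
        (auto simp: transpose_comp_comp permutes_compose t)
    also have "\<dots> = (\<Sum>\<sigma> | \<sigma> permutes {..<r}.
        - (of_int (sign \<sigma>) * cf a (permute_list \<sigma> (u @ [y, x] @ v))))"
    proof (rule sum.cong[OF refl])
      fix \<sigma> assume "\<sigma> \<in> {\<sigma>. \<sigma> permutes {..<r}}"
      then have \<sigma>: "\<sigma> permutes {..<r}" by simp
      have "sign (?t \<circ> \<sigma>) = - sign \<sigma>"
        using permutes_imp_permutation[OF finite_lessThan \<sigma>]
        by (subst sign_compose) (auto simp: sign_swap_id permutation_swap_id)
      moreover have "permute_list (?t \<circ> \<sigma>) (u @ [x, y] @ v) = permute_list \<sigma> (u @ [y, x] @ v)"
        using \<sigma> len by (subst permute_list_compose) (auto simp only: permute_list_swap)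
      ultimately show "of_int (sign (?t \<circ> \<sigma>)) * cf a (permute_list (?t \<circ> \<sigma>) (u @ [x, y] @ v)) =
        - (of_int (sign \<sigma>) * cf a (permute_list \<sigma> (u @ [y, x] @ v)))" by simp
    qed
    also have "\<dots> = - cf (Ant r a) (u @ [y, x] @ v)"
      unfolding cf_Ant[OF len'] by (simp add: sum_negf)
    finally show ?thesis .
  qed
  show ?thesis
    unfolding alternating_def
  proof (intro conjI allI)
    fix u x y v
    show "cf (Ant r a) (u @ [x, x] @ v) = 0"
      by (cases "length (u @ [x, x] @ v) = r") (rule 1, assumption, rule zero, assumption)
    show "cf (Ant r a) (u @ [x, y] @ v) = - cf (Ant r a) (u @ [y, x] @ v)"
    proof (cases "length (u @ [x, y] @ v) = r")
      case False
      then have swapped: "length (u @ [y, x] @ v) \<noteq> r" by simp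
      show ?thesis unfolding zero[OF False] zero[OF swapped] by simp
    qed (rule 2)
  qed
qed

text \<open>
  Bubble sort: exchanging two neighbouring letters in descending order makes a word smaller in the
  lexicographic order, which is well founded on words of a fixed length.
\<close>

lemma word_sort_induct [case_names sorted repeat swap]:
  fixes P :: "'b::{finite,linorder} list \<Rightarrow> bool"
  assumes sorted: "\<And>xs. sorted_wrt (<) xs \<Longrightarrow> P xs"
    and rep: "\<And>u x v. P (u @ [x, x] @ v)"
    and swap: "\<And>u x y v. P (u @ [y, x] @ v) \<Longrightarrow> P (u @ [x, y] @ v)"
  shows "P xs"
proof -
  let ?r = "{(a :: 'b, b). a < b}"
  have "card {..<a} < card {..<b}" if "a < b" for a b :: 'b
    using that by (intro psubset_card_mono) auto
  then have "?r \<subseteq> measure (\<lambda>b. card {..<b})" by auto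
  then have "wf ?r" by (rule wf_subset[OF wf_measure])
  then have "wf (lexn ?r (length xs))" by (rule wf_lexn)
  then have "length ys = length xs \<Longrightarrow> P ys" for ys
  proof (induction ys rule: wf_induct_rule)
    case (less ys)
    show ?case
    proof (cases "sorted_wrt (<) ys")
      case False
      then obtain i where i: "Suc i < length ys" "\<not> ys ! i < ys ! Suc i"
        by (subst (asm) sorted_wrt_iff_nth_Suc_transp) auto
      define u v where "u = take i ys" and "v = drop (Suc (Suc i)) ys"
      have ys: "ys = u @ [ys ! i, ys ! Suc i] @ v"
        using i(1) unfolding u_def v_def
        by (metis Cons_nth_drop_Suc Suc_lessD append_Cons append_Nil append_take_drop_id)
      have len: "length u + 2 + length v = length xs"
        using i(1) less.prems by (simp add: u_def v_def)
      show ?thesis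
      proof (cases "ys ! i = ys ! Suc i")
        case True
        then show ?thesis using rep[of u "ys ! i" v] ys by simp
      next
        case False
        with i(2) have lt: "ys ! Suc i < ys ! i" by simp
        have "(u @ [ys ! Suc i, ys ! i] @ v, u @ [ys ! i, ys ! Suc i] @ v) \<in> lexn ?r (length xs)"
          using lt len unfolding lexn_conv
          by (auto intro!: exI[of _ u])
        then have "(u @ [ys ! Suc i, ys ! i] @ v, ys) \<in> lexn ?r (length xs)" using ys by simp
        then have "P (u @ [ys ! Suc i, ys ! i] @ v)"
          by (rule less.IH) (use len in simp)
        then show ?thesis using swap ys by metis
      qed
    qed (rule sorted)
  qed
  then show ?thesis by simp
qed

lemma alternating_eqI:
  fixes a b :: "('b::{finite,linorder}, 'k::field) tensor"
  assumes "alternating a" "alternating b" "\<And>xs. sorted_wrt (<) xs \<Longrightarrow> cf a xs = cf b xs"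
  shows "a = b"
proof (rule tensor_eqI)
  fix xs show "cf a xs = cf b xs"
  proof (induction xs rule: word_sort_induct)
    case (repeat u x v)
    show ?case using assms(1,2) unfolding alternating_def by metis
  next
    case (swap u x y v)
    then show ?case using assms(1,2) unfolding alternating_def by metis
  qed (rule assms(3))
qed

text \<open>
  The strictly increasing words index the basis \<open>e\<^bsub>i\<^sub>1\<^esub> \<and> \<dots> \<and> e\<^bsub>i\<^sub>r\<^esub>\<close> of the exterior power, so this
  projection serves as an explicit linear left inverse of antisymmetrisation, up to classes in the
  exterior power.
\<close>

definition increasing_part :: "nat \<Rightarrow> ('b::linorder, 'k::field) tensor \<Rightarrow> ('b, 'k) tensor"
  where "increasing_part r = Poly_Mapping.mapp (\<lambda>w c. c when length (letters w) = r \<and> sorted_wrt (<) (letters w))"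

lemma cf_increasing_part: "cf (increasing_part r a) xs = (if length xs = r \<and> sorted_wrt (<) xs then cf a xs else 0)"
  by (simp add: increasing_part_def lookup_mapp when_def in_keys_iff)

lemma increasing_part_add: "increasing_part r (a + b) = increasing_part r a + increasing_part r b"
  by (rule tensor_eqI) (simp add: cf_increasing_part lookup_add)

lemma increasing_part_zero: "increasing_part r 0 = 0"
  by (rule tensor_eqI) (simp add: cf_increasing_part)

lemma increasing_part_scal: "increasing_part r (scal c * a) = scal c * increasing_part r a"
  by (rule tensor_eqI) (simp add: cf_increasing_part cf_scal_mult)

lemma increasing_part_tens_pow: "increasing_part r a \<in> tens_pow r"
  by (simp add: tens_pow_cf cf_increasing_part)

lemma increasing_part_wterm: "increasing_part (length xs) (wterm xs c) = (if sorted_wrt (<) xs then wterm xs c else 0)"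
  by (rule tensor_eqI) (auto simp: cf_increasing_part lookup_single when_def)

text \<open>
  A strictly increasing word is the only increasing rearrangement of itself, so in an
  antisymmetrisation it only receives the contribution of the identity.
\<close>

lemma sorted_permutes_id:
  fixes xs :: "'b::linorder list"
  assumes xs: "sorted_wrt (<) xs" and \<sigma>: "\<sigma> permutes {..<length xs}"
    and s: "sorted_wrt (<) (permute_list \<sigma> xs)"
  shows "\<sigma> = id"
proof -
  have "permute_list \<sigma> xs = xs"
    using sorted_distinct_set_unique[of "permute_list \<sigma> xs" xs] xs s \<sigma>
    by (simp add: strict_sorted_iff)
  moreover have "distinct xs" using xs by (simp add: strict_sorted_iff)
  ultimately have "\<sigma> i = i" if "i < length xs" for i
    using that \<sigma> permutes_in_image[OF \<sigma>, of i]
    by (metis lessThan_iff nth_eq_iff_index_eq permute_list_nth)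
  then show ?thesis
    using \<sigma> by (metis eq_id_iff lessThan_iff permutes_not_in)
qed

lemma cf_Ant_increasing_part:
  fixes a :: "('b::linorder, 'k::field) tensor"
  assumes "sorted_wrt (<) xs" "length xs = r"
  shows "cf (Ant r (increasing_part r a)) xs = cf a xs"
proof -
  have "cf (Ant r (increasing_part r a)) xs = (\<Sum>\<sigma> | \<sigma> permutes {..<r}. if \<sigma> = id then cf a xs else 0)"
    unfolding cf_Ant[OF assms(2)]
  proof (rule sum.cong[OF refl])
    fix \<sigma> assume "\<sigma> \<in> {\<sigma>. \<sigma> permutes {..<r}}"
    then have "sorted_wrt (<) (permute_list \<sigma> xs) \<longleftrightarrow> \<sigma> = id"
      using sorted_permutes_id[of xs \<sigma>] assms by auto
    then show "of_int (sign \<sigma>) * cf (increasing_part r a) (permute_list \<sigma> xs) = (if \<sigma> = id then cf a xs else 0)"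
      using assms by (simp add: cf_increasing_part)
  qed
  then show ?thesis by (simp add: finite_permutations permutes_id)
qed

text \<open>An alternating tensor is determined by its coefficients at strictly increasing words.\<close>

lemma alternating_Ant_increasing_part:
  fixes a :: "('b::{finite,linorder}, 'k::field) tensor"
  assumes "alternating a" "a \<in> tens_pow r"
  shows "Ant r (increasing_part r a) = a"
proof (rule alternating_eqI[OF alternating_Ant[OF increasing_part_tens_pow] assms(1)])
  fix xs :: "'b list" assume "sorted_wrt (<) xs"
  then show "cf (Ant r (increasing_part r a)) xs = cf a xs"
    using assms(2) cf_Ant_increasing_part[of xs r a] Ant_tens_pow[OF increasing_part_tens_pow, of r a]
    by (cases "length xs = r") (auto simp: tens_pow_cf)
qed

lemma Ant_small: "r \<le> 1 \<Longrightarrow> a \<in> tens_pow r \<Longrightarrow> Ant r a = a"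
proof (rule tens_pow_eqI[of _ r])
  fix xs :: "'a list" assume r: "r \<le> 1" "length xs = r"
  have "{..<r} \<subseteq> {0}" using r by auto
  then have "\<sigma> permutes {..<r} \<longleftrightarrow> \<sigma> = id" for \<sigma>
    by (metis permutes_id permutes_sing permutes_subset)
  then show "cf (Ant r a) xs = cf a xs" by (simp add: cf_Ant[OF r(2)])
qed (auto intro: Ant_tens_pow)

section \<open>Koszul relations\<close>

text \<open>
  Any two neighbouring positions lie in a window of \<open>N \<ge> 2\<close> consecutive positions, where the tensor
  is antisymmetric.
\<close>

lemma W_alternating:
  assumes "2 \<le> N" "N \<le> r" "a \<in> W N r"
  shows "alternating (a :: ('b, 'k::field) tensor)"
proof -
  have a: "a \<in> tens_pow r"
    and win: "\<And>i j. i + N + j = r \<Longrightarrow>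
      a \<in> tspan {u * \<rho> * v | u \<rho> v. u \<in> tens_pow i \<and> \<rho> \<in> sym_rels N \<and> v \<in> tens_pow j}"
    using assms(3) by (auto simp: W_def)
  have main: "cf a (u @ [x, x] @ v) = 0 \<and> cf a (u @ [x, y] @ v) = - cf a (u @ [y, x] @ v)"
    if len: "length u + 2 + length v = r" for u x y v
  proof -
    define i where "i = min (length u) (r - N)"
    define j where "j = r - N - i"
    have ij: "i + N + j = r" "i \<le> length u" "length u + 2 \<le> i + N"
      using assms(1,2) len by (auto simp: i_def j_def)
    have split: "cf (u' * \<rho> * v') (u @ [c, d] @ v) =
        cf u' (take i u) * cf \<rho> (drop i u @ [c, d] @ take (i + N - (length u + 2)) v) *
        cf v' (drop (i + N - (length u + 2)) v)"
      if "u' \<in> tens_pow i" "\<rho> \<in> sym_rels N" for u' \<rho> v' :: "('b, 'k) tensor" and c d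
    proof -
      have "\<rho> \<in> tens_pow N" using that(2) by (auto simp: sym_rels_def Ant_tens_pow)
      moreover have "take N (drop i u @ c # d # v) = drop i u @ [c, d] @ take (i + N - (length u + 2)) v"
        "drop N (drop i u @ c # d # v) = drop (i + N - (length u + 2)) v"
        using ij by (auto simp: take_Cons' drop_Cons' numeral_2_eq_2) (simp_all add: add.commute)
      ultimately show ?thesis
        using that(1) ij(2) by (simp add: mult.assoc cf_mult)
    qed
    from win[OF ij(1)] have "a \<in> tensor_module.span
        {u * \<rho> * v | u \<rho> v. u \<in> tens_pow i \<and> \<rho> \<in> sym_rels N \<and> v \<in> tens_pow j}"
      by (simp only: tspan_def)
    then show ?thesis
    proof (induction rule: tensor_module.span_induct_alt)
      case (step c b a)
      then obtain u' \<rho> v' where b: "b = u' * \<rho> * v'" "u' \<in> tens_pow i" "\<rho> \<in> sym_rels N" by auto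
      have "alternating \<rho>" using b(3) alternating_Ant by (auto simp: sym_rels_def)
      then have z: "cf \<rho> (L @ [x, x] @ R) = 0"
        and sw: "cf \<rho> (L @ [x, y] @ R) = - cf \<rho> (L @ [y, x] @ R)" for L R
        unfolding alternating_def by blast+
      have "cf b (u @ [x, x] @ v) = 0 \<and> cf b (u @ [x, y] @ v) = - cf b (u @ [y, x] @ v)"
        unfolding b(1) split[OF b(2,3)] z sw[of "drop i u"] by simp
      with step.IH show ?case
        by (simp only: lookup_add cf_scal_mult) (simp add: algebra_simps)
    qed simp
  qed
  show ?thesis unfolding alternating_def
  proof (intro conjI allI)
    fix u v :: "'b list" and x y :: 'b
    show "cf a (u @ [x, x] @ v) = 0"
      using main[of u v x x] a by (cases "length u + 2 + length v = r") (auto simp: tens_pow_cf)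
    show "cf a (u @ [x, y] @ v) = - cf a (u @ [y, x] @ v)"
      using main[of u v x y] a by (cases "length u + 2 + length v = r") (auto simp: tens_pow_cf)
  qed
qed

lemma W_imp_Ant:
  fixes a :: "('b::{finite,linorder}, 'k::field) tensor"
  assumes "2 \<le> N" "N \<le> r \<or> r \<le> 1" "a \<in> W N r"
  shows "Ant r (increasing_part r a) = a"
proof -
  have a: "a \<in> tens_pow r" using assms(3) by (simp add: W_def)
  show ?thesis
  proof (cases "N \<le> r")
    case True
    then show ?thesis using alternating_Ant_increasing_part[OF W_alternating[OF assms(1) True assms(3)] a] by simp
  next
    case False
    with assms(2) have r: "r \<le> 1" by simp
    have "sorted_wrt (<) xs" if "length xs = r" for xs :: "'b list"
      using that r by (cases xs) auto
    then have "increasing_part r a = a" using a by (intro tensor_eqI) (auto simp: cf_increasing_part tens_pow_cf)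
    then show ?thesis using Ant_small[OF r a] by simp
  qed
qed

section \<open>The exterior algebra\<close>

lemma type_ring_simps [simp]:
  "carrier type_ring = UNIV" "monoid.mult type_ring = (*)" "one type_ring = 1"
  "zero type_ring = 0" "add type_ring = (+)"
  by (simp_all add: type_ring_def)

lemma ring_type_ring: "ring (type_ring :: 'a::ring_1 ring)"
proof (rule ringI)
  show "abelian_group (type_ring :: 'a ring)"
    by (rule abelian_groupI) (auto simp: type_ring_def algebra_simps intro: exI[of _ "- _"])
  show "Group.monoid (type_ring :: 'a ring)"
    by (rule monoidI) (auto simp: type_ring_def algebra_simps)
qed (auto simp: type_ring_def algebra_simps)

lemma type_ring_minus: "a \<ominus>\<^bsub>type_ring\<^esub> b = (a - b :: 'a::ring_1)"
proof -
  interpret ring "type_ring :: 'a ring" by (rule ring_type_ring)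
  have "\<ominus>\<^bsub>type_ring\<^esub> b = - b"
    by (rule minus_equality) auto
  then show ?thesis by (simp add: a_minus_def)
qed

text \<open>
  In a ring with unit the sums of elements \<open>u s v\<close> with \<open>s\<close> in the generating set already form an
  ideal.
\<close>

lemma Idl_type_ring_induct [consumes 1, case_names zero gen add]:
  fixes x :: "'a::ring_1"
  assumes x: "x \<in> Idl\<^bsub>type_ring\<^esub> S" and zero: "P 0"
    and gen: "\<And>u s v. s \<in> S \<Longrightarrow> P (u * s * v)"
    and add: "\<And>a b. P a \<Longrightarrow> P b \<Longrightarrow> P (a + b)"
  shows "P x"
proof -
  interpret ring "type_ring :: 'a ring" by (rule ring_type_ring)
  let ?ev = "\<lambda>ts :: ('a \<times> 'a \<times> 'a) list. \<Sum>(u, s, v) \<leftarrow> ts. u * s * v"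
  let ?J = "{?ev ts | ts. set ts \<subseteq> UNIV \<times> S \<times> UNIV}"
  have lmult: "a * ?ev ts = ?ev (map (\<lambda>(u, s, v). (a * u, s, v)) ts)"
    and rmult: "?ev ts * a = ?ev (map (\<lambda>(u, s, v). (u, s, v * a)) ts)" for a ts
    by (induction ts) (auto simp: algebra_simps)
  have mem: "?ev ts \<in> ?J" if "set ts \<subseteq> UNIV \<times> S \<times> UNIV" for ts
    using that by blast
  have plus: "a + b \<in> ?J" if "a \<in> ?J" "b \<in> ?J" for a b
  proof -
    from that obtain ts us where "a = ?ev ts" "b = ?ev us"
      "set ts \<subseteq> UNIV \<times> S \<times> UNIV" "set us \<subseteq> UNIV \<times> S \<times> UNIV" by blast
    then show ?thesis using mem[of "ts @ us"] by simp
  qed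
  have left: "a * b \<in> ?J" if "b \<in> ?J" for a b
  proof -
    from that obtain ts where "b = ?ev ts" "set ts \<subseteq> UNIV \<times> S \<times> UNIV" by blast
    then show ?thesis using mem[of "map (\<lambda>(u, s, v). (a * u, s, v)) ts"] lmult[of a ts] by fastforce
  qed
  have right: "b * a \<in> ?J" if "b \<in> ?J" for a b
  proof -
    from that obtain ts where "b = ?ev ts" "set ts \<subseteq> UNIV \<times> S \<times> UNIV" by blast
    then show ?thesis using mem[of "map (\<lambda>(u, s, v). (u, s, v * a)) ts"] rmult[of ts a] by fastforce
  qed
  have inv: "\<ominus>\<^bsub>type_ring\<^esub> a = - a" for a :: 'a
    using type_ring_minus[of 0 a] by (simp add: a_minus_def)
  have "subgroup ?J (add_monoid type_ring)"
  proof (rule subgroup.intro)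
    show "\<one>\<^bsub>add_monoid type_ring\<^esub> \<in> ?J" using mem[of "[]"] by simp
    fix a assume "a \<in> ?J"
    then show "inv\<^bsub>add_monoid type_ring\<^esub> a \<in> ?J"
      using left[of a "-1"] inv[of a] by (simp add: a_inv_def)
  qed (use plus in auto)
  then have "ideal ?J type_ring"
    by (rule idealI[OF ring_type_ring]) (use left right in simp_all)
  moreover have "S \<subseteq> ?J"
  proof
    fix s assume "s \<in> S"
    then show "s \<in> ?J" using mem[of "[(1, s, 1)]"] by simp
  qed
  ultimately have "Idl\<^bsub>type_ring\<^esub> S \<subseteq> ?J" by (rule genideal_minimal)
  with x obtain ts where ts: "x = ?ev ts" "set ts \<subseteq> UNIV \<times> S \<times> UNIV" by blast
  from ts(2) have "P (?ev ts)" by (induction ts) (auto intro: zero gen add)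
  with ts(1) show ?thesis by simp
qed

lemma ideal_Idl_type_ring: "ideal (Idl\<^bsub>type_ring\<^esub> S) (type_ring :: 'a::ring_1 ring)"
  by (rule ring.genideal_ideal[OF ring_type_ring]) simp

lemma Idl_type_ring_closed:
  fixes a b :: "'a::ring_1"
  shows Idl_type_ring_add: "a \<in> Idl\<^bsub>type_ring\<^esub> S \<Longrightarrow> b \<in> Idl\<^bsub>type_ring\<^esub> S \<Longrightarrow> a + b \<in> Idl\<^bsub>type_ring\<^esub> S"
    and Idl_type_ring_diff: "a \<in> Idl\<^bsub>type_ring\<^esub> S \<Longrightarrow> b \<in> Idl\<^bsub>type_ring\<^esub> S \<Longrightarrow> a - b \<in> Idl\<^bsub>type_ring\<^esub> S"
    and Idl_type_ring_mult_left: "b \<in> Idl\<^bsub>type_ring\<^esub> S \<Longrightarrow> a * b \<in> Idl\<^bsub>type_ring\<^esub> S"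
    and Idl_type_ring_mult_right: "a \<in> Idl\<^bsub>type_ring\<^esub> S \<Longrightarrow> a * b \<in> Idl\<^bsub>type_ring\<^esub> S"
    and Idl_type_ring_gen: "a \<in> S \<Longrightarrow> a \<in> Idl\<^bsub>type_ring\<^esub> S"
proof -
  interpret ideal "Idl\<^bsub>type_ring\<^esub> S" "type_ring :: 'a ring" by (rule ideal_Idl_type_ring)
  have carr: "x \<in> carrier type_ring" for x :: 'a by simp
  show "a \<in> Idl\<^bsub>type_ring\<^esub> S \<Longrightarrow> b \<in> Idl\<^bsub>type_ring\<^esub> S \<Longrightarrow> a + b \<in> Idl\<^bsub>type_ring\<^esub> S"
    using additive_subgroup.a_closed[OF is_additive_subgroup, of a b] by simp
  show "b \<in> Idl\<^bsub>type_ring\<^esub> S \<Longrightarrow> a * b \<in> Idl\<^bsub>type_ring\<^esub> S" for a b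
    using I_l_closed[OF _ carr, of b a] by simp
  show "a \<in> Idl\<^bsub>type_ring\<^esub> S \<Longrightarrow> a * b \<in> Idl\<^bsub>type_ring\<^esub> S"
    using I_r_closed[OF _ carr, of a b] by simp
  show "a \<in> S \<Longrightarrow> a \<in> Idl\<^bsub>type_ring\<^esub> S"
    using genideal_self[of S] by auto
  show "a - b \<in> Idl\<^bsub>type_ring\<^esub> S" if "a \<in> Idl\<^bsub>type_ring\<^esub> S" "b \<in> Idl\<^bsub>type_ring\<^esub> S"
    using additive_subgroup.a_closed[OF is_additive_subgroup that(1) I_l_closed[OF that(2) carr, of "-1"]] by simp
qed

lemma coset_type_ring:
  fixes S :: "'a::ring_1 set"
  defines "I \<equiv> Idl\<^bsub>type_ring\<^esub> S"
  shows coset_type_ring_eq_iff: "I +>\<^bsub>type_ring\<^esub> a = I +>\<^bsub>type_ring\<^esub> b \<longleftrightarrow> a - b \<in> I"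
    and coset_type_ring_hom: "(+>\<^bsub>type_ring\<^esub>) I \<in> ring_hom type_ring (type_ring Quot I)"
    and coset_type_ring_mem: "b \<in> I +>\<^bsub>type_ring\<^esub> a \<longleftrightarrow> b - a \<in> I"
proof -
  interpret ideal I "type_ring :: 'a ring" unfolding I_def by (rule ideal_Idl_type_ring)
  show "I +>\<^bsub>type_ring\<^esub> a = I +>\<^bsub>type_ring\<^esub> b \<longleftrightarrow> a - b \<in> I"
    using quotient_eq_iff_same_a_r_cos[OF is_ideal, of a b]
    by (simp add: type_ring_minus)
  show "(+>\<^bsub>type_ring\<^esub>) I \<in> ring_hom type_ring (type_ring Quot I)" by (rule rcos_ring_hom)
  show "b \<in> I +>\<^bsub>type_ring\<^esub> a \<longleftrightarrow> b - a \<in> I"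
    by (auto simp: a_r_coset_def' type_ring_def intro: bexI[of _ "b - a"])
qed

lemma ext_proj_eq_iff: "ext_proj a = ext_proj b \<longleftrightarrow> a - b \<in> ext_null"
  unfolding ext_proj_def ext_null_def by (rule coset_type_ring_eq_iff)

lemma ext_proj_mem: "b \<in> ext_proj a \<longleftrightarrow> b - a \<in> ext_null"
  unfolding ext_proj_def ext_null_def by (rule coset_type_ring_mem)

lemma ext_proj_ring_hom: "ext_proj \<in> ring_hom type_ring ext_alg"
  using coset_type_ring_hom unfolding ext_proj_def[abs_def] ext_null_def ext_alg_def .

lemma ext_proj_add: "ext_proj (a + b) = ext_proj a \<oplus>\<^bsub>ext_alg\<^esub> ext_proj b"
  using ring_hom_add[OF ext_proj_ring_hom, of a b] by simp

lemma ext_proj_mult: "ext_proj (a * b) = ext_proj a \<otimes>\<^bsub>ext_alg\<^esub> ext_proj b"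
  using ring_hom_mult[OF ext_proj_ring_hom, of a b] by simp

lemmas ext_null_add = Idl_type_ring_add[where S = "{v * v | v. v \<in> tens_pow 1}", folded ext_null_def]
lemmas ext_null_diff = Idl_type_ring_diff[where S = "{v * v | v. v \<in> tens_pow 1}", folded ext_null_def]
lemmas ext_null_mult_left = Idl_type_ring_mult_left[where S = "{v * v | v. v \<in> tens_pow 1}", folded ext_null_def]
lemmas ext_null_mult_right = Idl_type_ring_mult_right[where S = "{v * v | v. v \<in> tens_pow 1}", folded ext_null_def]
lemmas ext_null_gen = Idl_type_ring_gen[where S = "{v * v | v. v \<in> tens_pow 1}", folded ext_null_def]

text \<open>
  A tensor \<open>u v v w\<close> does not change when the positions of the two factors \<open>v\<close> are exchanged, so its
  antisymmetrisation cancels in pairs.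
\<close>

lemma Ant_ext_null:
  assumes "a \<in> ext_null" "a \<in> tens_pow r"
  shows "Ant r a = (0 :: ('b, 'k::field) tensor)"
proof -
  have "(\<Sum>\<sigma> | \<sigma> permutes {..<length xs}. of_int (sign \<sigma>) * cf a (permute_list \<sigma> xs)) = 0" for xs
    using assms(1) unfolding ext_null_def
  proof (induction a rule: Idl_type_ring_induct)
    case (gen u s w)
    then obtain v :: "('b, 'k) tensor" where v: "v \<in> tens_pow 1" "s = v * v" by auto
    show ?case
    proof (induction u rule: tensor_induct)
      case (wterm ys c)
      let ?i = "length ys"
      let ?a = "wterm ys c * s * w"
      have cf: "cf ?a zs = cf (wterm ys c) (take ?i zs) * (cf v (take 1 (drop ?i zs)) *
          (cf v (take 1 (drop 1 (drop ?i zs))) * cf w (drop 1 (drop 1 (drop ?i zs)))))" for zs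
        unfolding v(2) mult.assoc cf_mult[OF tens_pow_wterm[OF refl]] cf_mult[OF v(1)] ..
      show ?case
      proof (cases "?i + 2 \<le> length xs")
        case True
        show ?thesis
        proof (rule signed_sum_cancel[where T = "\<lambda>\<sigma>. \<sigma> \<circ> transpose ?i (Suc ?i)" and i = ?i and j = "Suc ?i"])
          fix \<sigma> assume "\<sigma> permutes {..<length xs}"
          let ?zs = "permute_list \<sigma> xs"
          define L R where "L = take ?i ?zs" and "R = drop (Suc (Suc ?i)) ?zs"
          define x y where "x = ?zs ! ?i" and "y = ?zs ! Suc ?i"
          have L: "length L = ?i" and zs: "?zs = L @ [x, y] @ R"
            using True unfolding L_def R_def x_def y_def
            by (auto simp: Cons_nth_drop_Suc id_take_nth_drop[symmetric])
          have "permute_list (\<sigma> \<circ> transpose ?i (Suc ?i)) xs = L @ [y, x] @ R"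
            using True permute_list_swap[of L x y R] unfolding L
            by (subst permute_list_compose) (auto intro!: permutes_swap_id simp: zs)
          then show "cf ?a (permute_list (\<sigma> \<circ> transpose ?i (Suc ?i)) xs) = cf ?a ?zs"
            unfolding zs cf by (simp add: L)
        qed (use True in \<open>auto simp: transpose_comp_comp\<close>)
      next
        case False
        have "cf ?a (permute_list \<sigma> xs) = 0" for \<sigma>
        proof -
          have "length (take 1 (drop 1 (drop ?i (permute_list \<sigma> xs)))) \<noteq> 1" using False by simp
          then have "cf v (take 1 (drop 1 (drop ?i (permute_list \<sigma> xs)))) = 0"
            using v(1) unfolding tens_pow_cf by blast
          then show ?thesis unfolding cf by simp
        qed
        then show ?thesis by simp
      qed
    qed (simp_all add: distrib_right distrib_left lookup_add sum.distrib)
  qed (simp_all add: lookup_add distrib_left sum.distrib)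
  then show ?thesis
    using assms(2) by (intro tens_pow_eqI[of _ r]) (auto simp: cf_Ant intro: Ant_tens_pow)
qed

lemma zero_ext_null: "0 \<in> ext_null"
  using ext_proj_eq_iff[of 0 0] by simp

lemma ext_null_square: "wterm (u @ [x, x] @ v) c \<in> ext_null"
proof -
  have "wterm [x] 1 * wterm [x] 1 \<in> ext_null"
    by (rule ext_null_gen) (auto intro!: exI[of _ "wterm [x] 1"] tens_pow_wterm)
  then have "wterm u c * (wterm [x] 1 * wterm [x] 1) * wterm v 1 \<in> ext_null"
    by (rule ext_null_mult_right[OF ext_null_mult_left])
  then show ?thesis by (simp add: wterm_mult)
qed

lemma ext_null_swap: "wterm (u @ [x, y] @ v) c + wterm (u @ [y, x] @ v) c \<in> ext_null"
proof -
  let ?x = "wterm [x] (1 :: 'b)" and ?y = "wterm [y] (1 :: 'b)"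
  have sq: "t * t \<in> ext_null" if "t \<in> tens_pow 1" for t :: "('a, 'b) tensor"
    by (rule ext_null_gen) (use that in auto)
  have "(?x + ?y) * (?x + ?y) - ?x * ?x - ?y * ?y \<in> ext_null"
    by (intro ext_null_diff sq tens_pow_add tens_pow_wterm) auto
  then have "wterm u c * ((?x + ?y) * (?x + ?y) - ?x * ?x - ?y * ?y) * wterm v 1 \<in> ext_null"
    by (rule ext_null_mult_right[OF ext_null_mult_left])
  also have "wterm u c * ((?x + ?y) * (?x + ?y) - ?x * ?x - ?y * ?y) * wterm v 1 =
      wterm u c * (?x * ?y) * wterm v 1 + wterm u c * (?y * ?x) * wterm v 1"
    by (simp add: algebra_simps)
  finally show ?thesis by (simp add: wterm_mult)
qed

text \<open>
  Modulo the squares every tensor is congruent to a combination of strictly increasing words, and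
  antisymmetrising such a combination does not change its coefficients at increasing words.
\<close>

lemma increasing_part_Ant_ext_null:
  fixes a :: "('b::{finite,linorder}, 'k::field) tensor"
  assumes "a \<in> tens_pow r"
  shows "increasing_part r (Ant r a) - a \<in> ext_null"
  using assms
proof (induction a rule: tens_pow_induct)
  case zero
  show ?case by (simp add: Ant_zero increasing_part_zero zero_ext_null)
next
  case (add a b)
  then have "increasing_part r (Ant r (a + b)) - (a + b) = (increasing_part r (Ant r a) - a) + (increasing_part r (Ant r b) - b)"
    by (simp add: Ant_add increasing_part_add)
  with add show ?case by (simp only: ext_null_add)
next
  case (wterm xs c)
  then show ?case
  proof (induction xs rule: word_sort_induct)
    case (sorted xs)
    then have "increasing_part r (wterm xs c) = wterm xs c" using increasing_part_wterm[of xs c] by simp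
    moreover have "increasing_part r (Ant r (increasing_part r (wterm xs c))) = increasing_part r (wterm xs c)"
      by (rule tensor_eqI) (simp add: cf_increasing_part cf_Ant_increasing_part)
    ultimately show ?case
      by (simp add: zero_ext_null)
  next
    case (repeat u x v)
    have "Ant r (wterm (u @ [x, x] @ v) c) = 0"
      by (rule Ant_ext_null[OF ext_null_square tens_pow_wterm[OF repeat]])
    then have "increasing_part r (Ant r (wterm (u @ [x, x] @ v) c)) = 0"
      by (simp add: increasing_part_zero)
    then show ?case
      using ext_null_mult_left[OF ext_null_square[of u x v c], of "-1"] by simp
  next
    case (swap u x y v)
    let ?a = "wterm (u @ [x, y] @ v) c" and ?b = "wterm (u @ [y, x] @ v) c"
    have len: "?a \<in> tens_pow r" "?b \<in> tens_pow r"
      using swap.prems by (auto intro!: tens_pow_wterm)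
    have "Ant r ?a + Ant r ?b = 0"
      using Ant_ext_null[OF ext_null_swap tens_pow_add[OF len]] Ant_add[OF len] by simp
    then have "increasing_part r (Ant r ?a) + increasing_part r (Ant r ?b) = 0"
      unfolding increasing_part_add[symmetric] by (simp add: increasing_part_zero)
    then have "increasing_part r (Ant r ?a) - ?a = (0 - (increasing_part r (Ant r ?b) - ?b)) - (?a + ?b)"
      by (simp add: algebra_simps add_eq_0_iff)
    moreover have "increasing_part r (Ant r ?b) - ?b \<in> ext_null" using swap by simp
    moreover have "0 \<in> ext_null" by (simp add: zero_ext_null)
    ultimately show ?case using ext_null_diff ext_null_swap by metis
  qed
qed

lemma ext_proj_increasing_part_Ant:
  fixes a :: "('b::{finite,linorder}, 'k::field) tensor"
  assumes "a \<in> tens_pow r"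
  shows "ext_proj (increasing_part r (Ant r a)) = ext_proj a"
  using increasing_part_Ant_ext_null[OF assms] by (simp add: ext_proj_eq_iff)

text \<open>
  Antisymmetrisation is constant on the homogeneous representatives of a class, so the choice in
  \<^const>\<open>ext_phi\<close> is a choice from a singleton.
\<close>

lemma ext_phi_ext_proj:
  assumes "a \<in> tens_pow r"
  shows "ext_phi r (ext_proj a) = Ant r (a :: ('b, 'k::field) tensor)"
proof -
  have eq: "Ant r b = Ant r a" if "b \<in> ext_proj a" "b \<in> tens_pow r" for b
  proof -
    have d: "b - a \<in> tens_pow r"
      using tens_pow_add[OF that(2) tens_pow_uminus[OF assms]] by simp
    have "Ant r b = Ant r (b - a) + Ant r a"
      using Ant_add[OF d assms] by simp
    then show ?thesis using Ant_ext_null[OF _ d] that(1) by (simp add: ext_proj_mem)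
  qed
  have "a \<in> ext_proj a"
    using ext_proj_mem[of a a] ext_proj_eq_iff[of a a] by simp
  then have "Ant r ` (ext_proj a \<inter> tens_pow r) = {Ant r a}" using assms eq by blast
  then show ?thesis by (simp add: ext_phi_def)
qed

text \<open>
  The inverse of \<open>\<phi>\<^sub>r\<close> on \<open>W\<^sub>r\<close> takes the strictly increasing part.  The right-hand side makes
  sense for every tensor, which provides the linear extension of a cochain beyond \<open>W\<^sub>r\<close>.
\<close>

lemma cochain_of_ext_eq:
  fixes w :: "('b::{finite,linorder}, 'k::field) tensor"
  assumes "2 \<le> N" "N \<le> r \<or> r \<le> 1" "w \<in> W N r"
  shows "cochain_of_ext r f w = f (ext_proj (increasing_part r w))"
proof -
  let ?X = "inv_into (carrier (ext_pow r)) (ext_phi r) w"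
  have "w = ext_phi r (ext_proj (increasing_part r w))"
    using W_imp_Ant[OF assms] by (simp add: ext_phi_ext_proj[OF increasing_part_tens_pow])
  then have im: "w \<in> ext_phi r ` carrier (ext_pow r)"
    using increasing_part_tens_pow by (auto simp: ext_pow_def)
  then have "?X \<in> carrier (ext_pow r)" by (rule inv_into_into)
  then obtain a where a: "a \<in> tens_pow r" "?X = ext_proj a" by (auto simp: ext_pow_def)
  have "Ant r a = w" using f_inv_into_f[OF im] a by (simp add: ext_phi_ext_proj)
  with a ext_proj_increasing_part_Ant[OF a(1)] show ?thesis by (simp add: cochain_of_ext_def)
qed

section \<open>Shuffle decomposition of antisymmetrisers\<close>

lemma strict_mono_on_image_unique:
  fixes \<sigma> \<tau> :: "nat \<Rightarrow> nat"
  assumes "strict_mono_on {s..<t} \<sigma>" "strict_mono_on {s..<t} \<tau>" "\<sigma> ` {s..<t} = \<tau> ` {s..<t}"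
    and "k \<in> {s..<t}"
  shows "\<sigma> k = \<tau> k"
proof -
  have sorted: "sorted (map \<rho> [s..<t]) \<and> distinct (map \<rho> [s..<t])"
    if "strict_mono_on {s..<t} \<rho>" for \<rho> :: "nat \<Rightarrow> nat"
    using that strict_mono_on_imp_inj_on[OF that]
    by (auto simp: sorted_map distinct_map sorted_wrt_upt strict_mono_on_def
        intro!: sorted_wrt_mono_rel[OF _ sorted_wrt_upt, of _ _ "\<lambda>x y. \<rho> x \<le> \<rho> y"] less_imp_le)
  have "map \<sigma> [s..<t] = map \<tau> [s..<t]"
    using sorted[OF assms(1)] sorted[OF assms(2)] assms(3)
    by (intro sorted_distinct_set_unique) auto
  with assms(4) show ?thesis by (simp add: map_eq_conv)
qed

text \<open>
  The values of \<open>\<tau>\<close> on the block, listed in increasing order, are pulled back along \<open>\<tau>\<close>.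
\<close>

lemma ex_block_sorting:
  fixes \<tau> :: "nat \<Rightarrow> nat"
  assumes "inj \<tau>"
  shows "\<exists>\<alpha>. \<alpha> permutes {s..<t} \<and> strict_mono_on {s..<t} (\<tau> \<circ> \<alpha>)"
proof -
  let ?I = "{s..<t}"
  define ys where "ys = sorted_list_of_set (\<tau> ` ?I)"
  have len: "length ys = t - s"
    using assms by (simp add: ys_def card_image inj_on_subset)
  have ys: "set ys = \<tau> ` ?I" "distinct ys" "sorted_wrt (<) ys" by (simp_all add: ys_def)
  define \<alpha> where "\<alpha> x = (if x \<in> ?I then inv_into UNIV \<tau> (ys ! (x - s)) else x)" for x
  have \<tau>\<alpha>: "\<tau> (\<alpha> x) = ys ! (x - s)" if "x \<in> ?I" for x
  proof -
    have "ys ! (x - s) \<in> \<tau> ` ?I" using that len ys(1) nth_mem[of "x - s" ys] by auto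
    then show ?thesis using that by (auto simp: \<alpha>_def f_inv_into_f)
  qed
  have "bij_betw \<alpha> ?I ?I"
  proof -
    have "bij_betw (\<lambda>x. x - s) ?I {..<t - s}"
      by (rule bij_betw_byWitness[where f' = "\<lambda>x. x + s"]) auto
    from bij_betw_trans[OF this bij_betw_nth[OF ys(2) _ ys(1)[symmetric]]]
    have "bij_betw ((!) ys \<circ> (\<lambda>x. x - s)) ?I (\<tau> ` ?I)" by (simp add: len)
    moreover have "bij_betw (inv_into UNIV \<tau>) (\<tau> ` ?I) ?I"
      by (rule bij_betw_byWitness[where f' = \<tau>]) (use assms in \<open>auto simp: inv_f_f\<close>)
    ultimately have "bij_betw (inv_into UNIV \<tau> \<circ> ((!) ys \<circ> (\<lambda>x. x - s))) ?I ?I"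
      by (rule bij_betw_trans)
    then show ?thesis
      by (rule bij_betw_cong[THEN iffD1, rotated]) (simp add: \<alpha>_def)
  qed
  then have "\<alpha> permutes ?I" by (rule bij_imp_permutes) (auto simp: \<alpha>_def)
  moreover have "strict_mono_on ?I (\<tau> \<circ> \<alpha>)"
    using len by (auto simp: strict_mono_on_def \<tau>\<alpha> intro!: sorted_wrt_nth_less[OF ys(3)])
  ultimately show ?thesis by blast
qed

text \<open>
  The restriction of an increasing \<open>\<sigma>\<close> to the block is determined by the image of the block, which
  composition with \<open>\<alpha>\<close> does not change; hence the factorisation \<open>\<tau> = \<sigma> \<circ> \<alpha>\<close> is unique.  The set \<open>S\<close>
  is kept general so that a second block can be split off from the permutations that already increase
  on the first one.
\<close>

lemma sum_block_decomposition:
  fixes g :: "(nat \<Rightarrow> nat) \<Rightarrow> 'c::comm_monoid_add"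
  assumes S: "finite S" "\<And>\<sigma>. \<sigma> \<in> S \<Longrightarrow> inj \<sigma>"
    and closed: "\<And>\<sigma> \<alpha>. \<sigma> \<in> S \<Longrightarrow> \<alpha> permutes {s..<t} \<Longrightarrow> \<sigma> \<circ> \<alpha> \<in> S"
  shows "(\<Sum>\<tau>\<in>S. g \<tau>) =
    (\<Sum>\<sigma> \<in> {\<sigma> \<in> S. strict_mono_on {s..<t} \<sigma>}. \<Sum>\<alpha> | \<alpha> permutes {s..<t}. g (\<sigma> \<circ> \<alpha>))"
proof -
  let ?I = "{s..<t}" and ?S = "{\<sigma> \<in> S. strict_mono_on {s..<t} \<sigma>}"
  have "bij_betw (\<lambda>(\<sigma>, \<alpha>). \<sigma> \<circ> \<alpha>) (?S \<times> {\<alpha>. \<alpha> permutes ?I}) S"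
    unfolding bij_betw_def
  proof (intro conjI)
    show "inj_on (\<lambda>(\<sigma>, \<alpha>). \<sigma> \<circ> \<alpha>) (?S \<times> {\<alpha>. \<alpha> permutes ?I})"
    proof (rule inj_onI, clarify)
      fix \<sigma> \<sigma>' \<alpha> \<alpha>' :: "nat \<Rightarrow> nat"
      assume \<sigma>: "\<sigma> \<in> S" "strict_mono_on ?I \<sigma>" and \<sigma>': "\<sigma>' \<in> S" "strict_mono_on ?I \<sigma>'"
        and \<alpha>: "\<alpha> permutes ?I" and \<alpha>': "\<alpha>' permutes ?I" and eq: "\<sigma> \<circ> \<alpha> = \<sigma>' \<circ> \<alpha>'"
      have "\<sigma> ` ?I = (\<sigma> \<circ> \<alpha>) ` ?I" "\<sigma>' ` ?I = (\<sigma>' \<circ> \<alpha>') ` ?I"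
        by (simp_all only: image_comp[symmetric] permutes_image[OF \<alpha>] permutes_image[OF \<alpha>'])
      then have im: "\<sigma> ` ?I = \<sigma>' ` ?I" using eq by simp
      have "\<sigma> k = \<sigma>' k" for k
      proof (cases "k \<in> ?I")
        case True
        then show ?thesis by (rule strict_mono_on_image_unique[OF \<sigma>(2) \<sigma>'(2) im])
      next
        case False
        then show ?thesis using fun_cong[OF eq, of k] \<alpha> \<alpha>' by (simp add: permutes_not_in)
      qed
      then have \<sigma>\<sigma>': "\<sigma> = \<sigma>'" ..
      have "\<alpha> k = \<alpha>' k" for k
        using fun_cong[OF eq, of k] \<sigma>\<sigma>' S(2)[OF \<sigma>(1)] by (simp add: inj_eq)
      then have "\<alpha> = \<alpha>'" ..
      with \<sigma>\<sigma>' show "\<sigma> = \<sigma>' \<and> \<alpha> = \<alpha>'" ..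
    qed
    show "(\<lambda>(\<sigma>, \<alpha>). \<sigma> \<circ> \<alpha>) ` (?S \<times> {\<alpha>. \<alpha> permutes ?I}) = S"
    proof (intro subset_antisym subsetI)
      fix \<tau> assume \<tau>: "\<tau> \<in> S"
      obtain \<alpha> where \<alpha>: "\<alpha> permutes ?I" "strict_mono_on ?I (\<tau> \<circ> \<alpha>)"
        using ex_block_sorting[OF S(2)[OF \<tau>]] by blast
      have "\<tau> = (\<tau> \<circ> \<alpha>) \<circ> inv_into UNIV \<alpha>"
        using permutes_inv_o(1)[OF \<alpha>(1)] by (simp add: comp_assoc)
      then show "\<tau> \<in> (\<lambda>(\<sigma>, \<alpha>). \<sigma> \<circ> \<alpha>) ` (?S \<times> {\<alpha>. \<alpha> permutes ?I})"
        using \<alpha> closed[OF \<tau> \<alpha>(1)] permutes_inv[OF \<alpha>(1)]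
        by (intro image_eqI[where x = "(\<tau> \<circ> \<alpha>, inv_into UNIV \<alpha>)"]) auto
    qed (use closed in auto)
  qed
  then have "(\<Sum>\<tau>\<in>S. g \<tau>) = (\<Sum>(\<sigma>, \<alpha>) \<in> ?S \<times> {\<alpha>. \<alpha> permutes ?I}. g (\<sigma> \<circ> \<alpha>))"
    by (subst sum.reindex_bij_betw[symmetric]) (auto simp: case_prod_unfold)
  then show ?thesis by (simp add: sum.cartesian_product)
qed

lemma Ant_block:
  fixes h :: "nat \<Rightarrow> 'b"
  assumes "t = s + r"
  shows "Ant r (wterm (map h [s..<t]) (1 :: 'k::field)) =
    (\<Sum>\<alpha> | \<alpha> permutes {s..<t}. wterm (map (\<lambda>k. h (\<alpha> k)) [s..<t]) (of_int (sign \<alpha>)))"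
proof -
  define \<Phi> where "\<Phi> \<pi> x = (if x \<in> {s..<t} then s + \<pi> (inv_into {..<r} (\<lambda>x. s + x) x) else x)"
    for \<pi> x
  have bij: "bij_betw (\<lambda>x. s + x) {..<r} {s..<t}"
    by (rule bij_betw_byWitness[where f' = "\<lambda>x. x - s"]) (auto simp: assms)
  have inj: "inj_on (\<lambda>x. s + x) {..<r}" using bij by (rule bij_betw_imp_inj_on)
  have \<Phi>: "\<Phi> \<pi> (s + k) = s + \<pi> k" if "k < r" for \<pi> k
    using that inj assms by (simp add: \<Phi>_def inv_into_f_f)
  have "bij_betw \<Phi> {\<pi>. \<pi> permutes {..<r}} {\<alpha>. \<alpha> permutes {s..<t}}"
    using bij_betw_permutations[OF bij] unfolding \<Phi>_def[abs_def] .
  then have "(\<Sum>\<alpha> | \<alpha> permutes {s..<t}. wterm (map (\<lambda>k. h (\<alpha> k)) [s..<t]) (of_int (sign \<alpha>) :: 'k)) =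
    (\<Sum>\<pi> | \<pi> permutes {..<r}. wterm (map (\<lambda>k. h (\<Phi> \<pi> k)) [s..<t]) (of_int (sign (\<Phi> \<pi>))))"
    by (rule sum.reindex_bij_betw[symmetric])
  also have "\<dots> = (\<Sum>\<pi> | \<pi> permutes {..<r}.
      wterm (permute_list \<pi> (map h [s..<t])) (of_int (sign \<pi>) * 1))"
  proof (rule sum.cong[OF refl])
    fix \<pi> assume "\<pi> \<in> {\<pi>. \<pi> permutes {..<r}}"
    then have \<pi>: "\<pi> permutes {..<r}" by simp
    have "(\<lambda>x. s + x) ` {..<r} = {s..<t}" using bij by (rule bij_betw_imp_surj_on)
    then have "\<Phi> \<pi> = map_permutation {..<r} (\<lambda>x. s + x) \<pi>"
      by (auto simp: \<Phi>_def map_permutation_def restrict_id_def fun_eq_iff)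
    then have "sign (\<Phi> \<pi>) = sign \<pi>" using sign_map_permutation[OF inj \<pi>] by simp
    moreover have "map (\<lambda>k. h (\<Phi> \<pi> k)) [s..<t] = permute_list \<pi> (map h [s..<t])"
    proof (rule nth_equalityI)
      fix k assume "k < length (map (\<lambda>k. h (\<Phi> \<pi> k)) [s..<t])"
      then have k: "k < r" using assms by simp
      moreover have "\<pi> k < r" using permutes_in_image[OF \<pi>, of k] k by simp
      ultimately show "map (\<lambda>k. h (\<Phi> \<pi> k)) [s..<t] ! k = permute_list \<pi> (map h [s..<t]) ! k"
        using assms \<pi> by (simp add: permute_list_nth \<Phi> del: upt_Suc)
    qed simp
    ultimately show "wterm (map (\<lambda>k. h (\<Phi> \<pi> k)) [s..<t]) (of_int (sign (\<Phi> \<pi>))) =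
      wterm (permute_list \<pi> (map h [s..<t])) (of_int (sign \<pi>) * 1 :: 'k)" by simp
  qed
  also have "\<dots> = Ant r (wterm (map h [s..<t]) 1)"
    using Ant_wterm[of "map h [s..<t]" "1 :: 'k"] assms by simp
  finally show ?thesis ..
qed

text \<open>
  Every permutation is uniquely a permutation increasing on both blocks, followed by rearrangements
  of the arguments within the blocks; summing over the rearrangements antisymmetrises each block.
\<close>

lemma Ant_shuffle:
  fixes h :: "nat \<Rightarrow> 'b"
  assumes n: "n = i + a + l + b + j"
  defines "X \<equiv> \<lambda>\<sigma> s t. wterm (map (\<lambda>k. h (\<sigma> k)) [s..<t]) (1 :: 'k::field)"
  shows "Ant n (wterm (map h [0..<n]) 1) = (\<Sum>\<sigma> \<in> Sh n i a b j.
    X \<sigma> 0 i * (of_int (sign \<sigma>) * Ant a (X \<sigma> i (i + a))) * X \<sigma> (i + a) (n - b - j) *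
    Ant b (X \<sigma> (n - b - j) (n - j)) * X \<sigma> (n - j) n)"
proof -
  define J where "J = n - b - j"
  have J: "J = i + a + l" "n - j = J + b" "n = J + b + j" using n by (auto simp: J_def)
  let ?P = "{\<sigma>. \<sigma> permutes {..<n}}"
  let ?P1 = "{\<sigma> \<in> ?P. strict_mono_on {i..<i + a} \<sigma>}"
  let ?g = "\<lambda>\<tau>. wterm (map (\<lambda>k. h (\<tau> k)) [0..<n]) (of_int (sign \<tau>) :: 'k)"
  have fin: "finite ?P" by (simp add: finite_permutations)
  have sub: "\<alpha> permutes {..<n}" if "\<alpha> permutes {s..<t}" "t \<le> n" for \<alpha> s t
    using that by (auto intro: permutes_subset)
  have "Ant n (wterm (map h [0..<n]) 1) = (\<Sum>\<tau>\<in>?P. ?g \<tau>)"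
    using Ant_block[of n 0 n h] by (simp add: atLeast0LessThan)
  also have "\<dots> = (\<Sum>\<sigma>\<in>?P1. \<Sum>\<alpha> | \<alpha> permutes {i..<i + a}. ?g (\<sigma> \<circ> \<alpha>))"
  proof (rule sum_block_decomposition)
    fix \<sigma> \<alpha> assume "\<sigma> \<in> ?P" "\<alpha> permutes {i..<i + a}"
    then show "\<sigma> \<circ> \<alpha> \<in> ?P" using sub[of \<alpha> i "i + a"] n by (simp add: permutes_compose)
  qed (use fin in \<open>auto intro: permutes_inj\<close>)
  also have "\<dots> = (\<Sum>\<sigma> \<in> {\<sigma> \<in> ?P1. strict_mono_on {J..<J + b} \<sigma>}. \<Sum>\<beta> | \<beta> permutes {J..<J + b}.
      \<Sum>\<alpha> | \<alpha> permutes {i..<i + a}. ?g (\<sigma> \<circ> \<beta> \<circ> \<alpha>))"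
  proof (rule sum_block_decomposition)
    fix \<sigma> \<beta> assume \<sigma>: "\<sigma> \<in> ?P1" and \<beta>: "\<beta> permutes {J..<J + b}"
    have "(\<sigma> \<circ> \<beta>) k = \<sigma> k" if "k \<in> {i..<i + a}" for k
      using that J(1) permutes_not_in[OF \<beta>, of k] by simp
    then have "strict_mono_on {i..<i + a} (\<sigma> \<circ> \<beta>)" using \<sigma> by (simp add: strict_mono_on_def)
    moreover have "\<sigma> \<circ> \<beta> permutes {..<n}"
      using \<sigma> sub[OF \<beta>] J(3) by (auto intro: permutes_compose)
    ultimately show "\<sigma> \<circ> \<beta> \<in> ?P1" by simp
  qed (use fin in \<open>auto intro: permutes_inj\<close>)
  also have "{\<sigma> \<in> ?P1. strict_mono_on {J..<J + b} \<sigma>} = Sh n i a b j"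
    unfolding Sh_def J_def[symmetric] J(2) by auto
  also have "(\<Sum>\<sigma> \<in> Sh n i a b j. \<Sum>\<beta> | \<beta> permutes {J..<J + b}.
      \<Sum>\<alpha> | \<alpha> permutes {i..<i + a}. ?g (\<sigma> \<circ> \<beta> \<circ> \<alpha>)) =
    (\<Sum>\<sigma> \<in> Sh n i a b j.
    X \<sigma> 0 i * (of_int (sign \<sigma>) * Ant a (X \<sigma> i (i + a))) * X \<sigma> (i + a) J *
    Ant b (X \<sigma> J (J + b)) * X \<sigma> (J + b) n)"
  proof (rule sum.cong[OF refl])
    fix \<sigma> assume "\<sigma> \<in> Sh n i a b j"
    then have \<sigma>: "\<sigma> permutes {..<n}" by (simp add: Sh_def)
    have summand: "?g (\<sigma> \<circ> \<beta> \<circ> \<alpha>) =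
        X \<sigma> 0 i * (of_int (sign \<sigma>) * wterm (map (\<lambda>k. h (\<sigma> (\<alpha> k))) [i..<i + a]) (of_int (sign \<alpha>))) *
        X \<sigma> (i + a) J * wterm (map (\<lambda>k. h (\<sigma> (\<beta> k))) [J..<J + b]) (of_int (sign \<beta>)) * X \<sigma> (J + b) n"
      if \<alpha>: "\<alpha> permutes {i..<i + a}" and \<beta>: "\<beta> permutes {J..<J + b}" for \<alpha> \<beta>
    proof -
      have sgn: "sign (\<sigma> \<circ> \<beta> \<circ> \<alpha>) = sign \<sigma> * sign \<alpha> * sign \<beta>"
        using permutes_imp_permutation[OF _ \<sigma>] permutes_imp_permutation[OF _ \<alpha>]
          permutes_imp_permutation[OF _ \<beta>]
        by (simp add: sign_compose permutation_compose)
      have upt: "[0..<n] = [0..<i] @ [i..<i + a] @ [i + a..<J] @ [J..<J + b] @ [J + b..<n]"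
        using upt_add_eq_append[of 0 i "a + l + b + j"] upt_add_eq_append[of i "i + a" "l + b + j"]
          upt_add_eq_append[of "i + a" "i + a + l" "b + j"] upt_add_eq_append[of "i + a + l" "i + a + l + b" j]
        by (simp add: J n add.assoc)
      have "(\<sigma> \<circ> \<beta> \<circ> \<alpha>) k = \<sigma> (\<alpha> k)" if "k \<in> {i..<i + a}" for k
        using permutes_in_image[OF \<alpha>, of k] that J(1) permutes_not_in[OF \<beta>, of "\<alpha> k"] by simp
      moreover have "(\<sigma> \<circ> \<beta> \<circ> \<alpha>) k = \<sigma> (\<beta> k)" if "k \<in> {J..<J + b}" for k
        using that J(1) permutes_not_in[OF \<alpha>, of k] by simp
      moreover have "(\<sigma> \<circ> \<beta> \<circ> \<alpha>) k = \<sigma> k" if "k \<notin> {i..<i + a}" "k \<notin> {J..<J + b}" for k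
        using that permutes_not_in[OF \<alpha>, of k] permutes_not_in[OF \<beta>, of k] by simp
      ultimately have "map (\<lambda>k. h ((\<sigma> \<circ> \<beta> \<circ> \<alpha>) k)) [0..<n] = map (\<lambda>k. h (\<sigma> k)) [0..<i] @
          map (\<lambda>k. h (\<sigma> (\<alpha> k))) [i..<i + a] @ map (\<lambda>k. h (\<sigma> k)) [i + a..<J] @
          map (\<lambda>k. h (\<sigma> (\<beta> k))) [J..<J + b] @ map (\<lambda>k. h (\<sigma> k)) [J + b..<n]"
        unfolding upt using J(1) by (auto simp del: comp_apply)
      then show ?thesis
        by (simp add: X_def wterm_mult of_int_wterm sgn del: comp_apply upt_Suc)
    qed
    have distrib: "(\<Sum>\<beta>\<in>B. \<Sum>\<alpha>\<in>A. u * (c * y \<alpha>) * v * w \<beta> * s) =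
        u * (c * (\<Sum>\<alpha>\<in>A. y \<alpha>)) * v * (\<Sum>\<beta>\<in>B. w \<beta>) * s"
      for u c v s :: "('b, 'k) tensor" and y w :: "(nat \<Rightarrow> nat) \<Rightarrow> ('b, 'k) tensor" and A B
      by (simp add: sum_distrib_left sum_distrib_right)
    have "(\<Sum>\<beta> | \<beta> permutes {J..<J + b}. \<Sum>\<alpha> | \<alpha> permutes {i..<i + a}. ?g (\<sigma> \<circ> \<beta> \<circ> \<alpha>)) =
      (\<Sum>\<beta> | \<beta> permutes {J..<J + b}. \<Sum>\<alpha> | \<alpha> permutes {i..<i + a}.
        X \<sigma> 0 i * (of_int (sign \<sigma>) * wterm (map (\<lambda>k. h (\<sigma> (\<alpha> k))) [i..<i + a]) (of_int (sign \<alpha>))) *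
        X \<sigma> (i + a) J * wterm (map (\<lambda>k. h (\<sigma> (\<beta> k))) [J..<J + b]) (of_int (sign \<beta>)) * X \<sigma> (J + b) n)"
      by (intro sum.cong refl summand) auto
    then show "(\<Sum>\<beta> | \<beta> permutes {J..<J + b}. \<Sum>\<alpha> | \<alpha> permutes {i..<i + a}. ?g (\<sigma> \<circ> \<beta> \<circ> \<alpha>)) =
      X \<sigma> 0 i * (of_int (sign \<sigma>) * Ant a (X \<sigma> i (i + a))) * X \<sigma> (i + a) J *
      Ant b (X \<sigma> J (J + b)) * X \<sigma> (J + b) n"
      unfolding distrib by (simp add: X_def Ant_block[OF refl])
  qed
  finally show ?thesis unfolding J_def[symmetric] J(2) .
qed

text \<open>
  The shuffle decomposition with a single block of length \<open>N\<close> exhibits an antisymmetrised tensor as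
  an element of each \<open>V\<^sup>\<otimes>\<^sup>i \<otimes> R \<otimes> V\<^sup>\<otimes>\<^sup>j\<close>.
\<close>

lemma Ant_in_W:
  fixes a :: "('b, 'k::field) tensor"
  assumes "a \<in> tens_pow r"
  shows "Ant r a \<in> W N r"
proof -
  have "Ant r a \<in> tspan {u * \<rho> * v | u \<rho> v. u \<in> tens_pow i \<and> \<rho> \<in> sym_rels N \<and> v \<in> tens_pow j}"
    if r: "r = i + N + j" for i j
  proof -
    let ?G = "{u * \<rho> * v | u \<rho> v. u \<in> tens_pow i \<and> \<rho> \<in> sym_rels N \<and> v \<in> tens_pow j} :: ('b, 'k) tensor set"
    have mon: "Ant r (wterm xs 1) \<in> tensor_module.span ?G" if len: "length xs = r" for xs
    proof -
      let ?X = "\<lambda>\<sigma> s t. wterm (map (\<lambda>k. xs ! \<sigma> k) [s..<t]) (1 :: 'k)"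
      have "wterm xs 1 = wterm (map (\<lambda>k. xs ! k) [0..<r]) (1 :: 'k)" using len map_nth[of xs] by simp
      then have "Ant r (wterm xs 1) = (\<Sum>\<sigma> \<in> Sh r i N 0 j.
          ?X \<sigma> 0 i * (of_int (sign \<sigma>) * Ant N (?X \<sigma> i (i + N))) * ?X \<sigma> (i + N) (r - 0 - j) *
          Ant 0 (?X \<sigma> (r - 0 - j) (r - j)) * ?X \<sigma> (r - j) r)"
        using Ant_shuffle[of r i N 0 0 j "\<lambda>k. xs ! k"] r by simp
      also have "\<dots> \<in> tensor_module.span ?G"
      proof (rule tensor_module.span_sum, rule tensor_module.span_base)
        fix \<sigma> :: "nat \<Rightarrow> nat"
        let ?s = "of_int (sign \<sigma>) :: ('b, 'k) tensor"
        have "?s = scal (of_int (sign \<sigma>))" by (simp add: of_int_wterm scal_wterm)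
        then have "?s * Ant N (?X \<sigma> i (i + N)) = Ant N (?s * ?X \<sigma> i (i + N))"
          by (simp add: Ant_scal tens_pow_wterm)
        moreover have "?s * ?X \<sigma> i (i + N) \<in> tens_pow N"
          by (simp add: of_int_wterm wterm_mult tens_pow_wterm)
        ultimately have rel: "?s * Ant N (?X \<sigma> i (i + N)) \<in> sym_rels N" by (simp add: sym_rels_def)
        have "?X \<sigma> (i + N) (r - 0 - j) * Ant 0 (?X \<sigma> (r - 0 - j) (r - j)) = 1"
          using r by (simp add: Ant_small tens_pow_wterm wterm_mult one_wterm)
        then have "?X \<sigma> 0 i * (?s * Ant N (?X \<sigma> i (i + N))) * ?X \<sigma> (i + N) (r - 0 - j) *
          Ant 0 (?X \<sigma> (r - 0 - j) (r - j)) * ?X \<sigma> (r - j) r =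
          ?X \<sigma> 0 i * (?s * Ant N (?X \<sigma> i (i + N))) * ?X \<sigma> (r - j) r"
          by (simp only: mult.assoc) (simp flip: mult.assoc)
        moreover have "?X \<sigma> 0 i \<in> tens_pow i" "?X \<sigma> (r - j) r \<in> tens_pow j"
          using r by (auto intro: tens_pow_wterm)
        ultimately show "?X \<sigma> 0 i * (?s * Ant N (?X \<sigma> i (i + N))) * ?X \<sigma> (i + N) (r - 0 - j) *
          Ant 0 (?X \<sigma> (r - 0 - j) (r - j)) * ?X \<sigma> (r - j) r \<in> ?G"
          using rel by blast
      qed
      finally show ?thesis .
    qed
    show ?thesis
      unfolding tspan_def
      using assms
    proof (induction a rule: tens_pow_induct)
      case zero
      show ?case by (simp add: Ant_zero tensor_module.span_zero)
    next
      case (wterm xs c)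
      have "Ant r (wterm xs c) = scal c * Ant r (wterm xs 1)"
        using wterm Ant_scal[of "wterm xs 1" r c] by (simp add: tens_pow_wterm scal_wterm wterm_mult)
      with mon[OF wterm] show ?case by (simp only: tensor_module.span_scale)
    next
      case (add a b)
      then show ?case by (simp only: Ant_add tensor_module.span_add)
    qed
  qed
  then show ?thesis by (auto simp: W_def Ant_tens_pow[OF assms])
qed

section \<open>Tensor products by generators and relations\<close>

text \<open>
  Closure under the two actions that enter the balancing relation puts all relators into the free
  abelian group, which makes the tensor product an abelian group.  Its elements are handled through
  representatives there, where sums are the sums of a type class.
\<close>

locale balanced_pair =
  fixes A :: "('a, 'c) ring_scheme" and X :: "('a, 'x) bimod" and Y :: "('a, 'y) bimod"
  assumes X: "abelian_group X" and Y: "abelian_group Y"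
    and rsmult_closed: "\<And>x a. x \<in> carrier X \<Longrightarrow> a \<in> carrier A \<Longrightarrow> rsmult X x a \<in> carrier X"
    and smult_closed: "\<And>y a. y \<in> carrier Y \<Longrightarrow> a \<in> carrier A \<Longrightarrow> smult Y a y \<in> carrier Y"
begin

abbreviation null :: "('x \<times> 'y \<Rightarrow>\<^sub>0 int) set" where "null \<equiv> tensor_null A X Y"
abbreviation cls :: "('x \<times> 'y \<Rightarrow>\<^sub>0 int) \<Rightarrow> ('x \<times> 'y \<Rightarrow>\<^sub>0 int) set"
  where "cls \<equiv> tensor_class A X Y"
abbreviation T :: "('a, ('x \<times> 'y \<Rightarrow>\<^sub>0 int) set) bimod" where "T \<equiv> tensor_prod A X Y"
definition frags :: "('x \<times> 'y \<Rightarrow>\<^sub>0 int) set"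
  where "frags = {u. Poly_Mapping.keys u \<subseteq> carrier X \<times> carrier Y}"

lemma frags_closed:
  shows frags_zero: "0 \<in> frags" and frags_add: "u \<in> frags \<Longrightarrow> v \<in> frags \<Longrightarrow> u + v \<in> frags"
    and frags_uminus: "u \<in> frags \<Longrightarrow> - u \<in> frags"
    and frags_diff: "u \<in> frags \<Longrightarrow> v \<in> frags \<Longrightarrow> u - v \<in> frags"
    and frags_of: "x \<in> carrier X \<Longrightarrow> y \<in> carrier Y \<Longrightarrow> frag_of (x, y) \<in> frags"
  using keys_add[of u v] keys_diff[of u v] by (auto simp: frags_def)

lemma frags_sum: "(\<And>i. i \<in> I \<Longrightarrow> u i \<in> frags) \<Longrightarrow> sum u I \<in> frags"
  by (induction I rule: infinite_finite_induct) (auto intro: frags_zero frags_add)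

lemma rels_frags: "tensor_rels A X Y \<subseteq> frags"
proof -
  interpret X: abelian_group X by (rule X)
  interpret Y: abelian_group Y by (rule Y)
  show ?thesis
    unfolding tensor_rels_def
    by (auto intro!: frags_diff frags_of rsmult_closed smult_closed)
qed

lemma null_subgroup: "subgroup null (tensor_free X Y)"
  unfolding tensor_null_def
  using rels_frags by (intro group.generate_is_subgroup) (auto simp: frags_def)

lemma null_frags: "u \<in> null \<Longrightarrow> u \<in> frags"
  using subgroup.mem_carrier[OF null_subgroup] by (simp add: frags_def)

lemma null_zero: "0 \<in> null"
  and null_add: "u \<in> null \<Longrightarrow> v \<in> null \<Longrightarrow> u + v \<in> null"
  and null_uminus: "u \<in> null \<Longrightarrow> - u \<in> null"
  using subgroup.one_closed[OF null_subgroup] subgroup.m_closed[OF null_subgroup, of u v]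
    subgroup.m_inv_closed[OF null_subgroup, of u] null_frags[of u]
  by (simp_all add: frags_def)

lemma null_diff: "u \<in> null \<Longrightarrow> v \<in> null \<Longrightarrow> u - v \<in> null"
  using null_add[of u "- v"] null_uminus[of v] by simp

lemma null_diff_commute: "u - v \<in> null \<longleftrightarrow> v - u \<in> null"
  using null_uminus[of "u - v"] null_uminus[of "v - u"] by auto

lemma null_trans: "u - v \<in> null \<Longrightarrow> v - w \<in> null \<Longrightarrow> u - w \<in> null"
  using null_add[of "u - v" "v - w"] by simp

lemma null_sum: "(\<And>i. i \<in> I \<Longrightarrow> u i \<in> null) \<Longrightarrow> sum u I \<in> null"
  by (induction I rule: infinite_finite_induct) (auto intro: null_zero null_add)

lemma null_rel: "r \<in> tensor_rels A X Y \<Longrightarrow> r \<in> null"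
  unfolding tensor_null_def by (rule generate.incl)

lemma null_add_left:
  assumes "x \<in> carrier X" "x' \<in> carrier X" "y \<in> carrier Y"
  shows "frag_of (x \<oplus>\<^bsub>X\<^esub> x', y) - (frag_of (x, y) + frag_of (x', y)) \<in> null"
proof -
  have "frag_of (x \<oplus>\<^bsub>X\<^esub> x', y) - frag_of (x, y) - frag_of (x', y) \<in> null"
    by (rule null_rel) (use assms in \<open>auto simp: tensor_rels_def\<close>)
  then show ?thesis by (simp only: diff_diff_eq)
qed

lemma null_add_right:
  assumes "x \<in> carrier X" "y \<in> carrier Y" "y' \<in> carrier Y"
  shows "frag_of (x, y \<oplus>\<^bsub>Y\<^esub> y') - (frag_of (x, y) + frag_of (x, y')) \<in> null"
proof -
  have "frag_of (x, y \<oplus>\<^bsub>Y\<^esub> y') - frag_of (x, y) - frag_of (x, y') \<in> null"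
    by (rule null_rel) (use assms in \<open>auto simp: tensor_rels_def\<close>)
  then show ?thesis by (simp only: diff_diff_eq)
qed

lemma null_balanced:
  assumes "x \<in> carrier X" "a \<in> carrier A" "y \<in> carrier Y"
  shows "frag_of (rsmult X x a, y) - frag_of (x, smult Y a y) \<in> null"
  by (rule null_rel) (use assms in \<open>auto simp: tensor_rels_def\<close>)

lemma null_zero_right:
  assumes "x \<in> carrier X"
  shows "frag_of (x, \<zero>\<^bsub>Y\<^esub>) \<in> null"
proof -
  interpret Y: abelian_group Y by (rule Y)
  show ?thesis using null_uminus[OF null_add_right[OF assms, of "\<zero>\<^bsub>Y\<^esub>" "\<zero>\<^bsub>Y\<^esub>"]] by simp
qed

text \<open>
  The universal property at the level of representatives, with \<open>K\<close> the subgroup to be divided out in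
  the target.
\<close>

lemma null_extend:
  assumes zero: "0 \<in> K" and plus: "\<And>u v. u \<in> K \<Longrightarrow> v \<in> K \<Longrightarrow> u + v \<in> K"
    and minus: "\<And>u. u \<in> K \<Longrightarrow> - u \<in> K"
    and left: "\<And>x x' y. x \<in> carrier X \<Longrightarrow> x' \<in> carrier X \<Longrightarrow> y \<in> carrier Y \<Longrightarrow>
      \<phi> (x \<oplus>\<^bsub>X\<^esub> x', y) - (\<phi> (x, y) + \<phi> (x', y)) \<in> K"
    and right: "\<And>x y y'. x \<in> carrier X \<Longrightarrow> y \<in> carrier Y \<Longrightarrow> y' \<in> carrier Y \<Longrightarrow>
      \<phi> (x, y \<oplus>\<^bsub>Y\<^esub> y') - (\<phi> (x, y) + \<phi> (x, y')) \<in> K"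
    and balanced: "\<And>x a y. x \<in> carrier X \<Longrightarrow> a \<in> carrier A \<Longrightarrow> y \<in> carrier Y \<Longrightarrow>
      \<phi> (rsmult X x a, y) - \<phi> (x, smult Y a y) \<in> K"
    and u: "u \<in> null"
  shows "frag_extend \<phi> u \<in> (K :: ('z \<Rightarrow>\<^sub>0 int) set)"
proof -
  have rel: "frag_extend \<phi> r \<in> K" if "r \<in> tensor_rels A X Y" for r
    using that left right balanced unfolding tensor_rels_def
    by (auto simp: frag_extend_diff frag_extend_add diff_diff_eq)
  show ?thesis
    using u unfolding tensor_null_def
  proof (induction u rule: generate.induct)
    case (inv r)
    then have "inv\<^bsub>tensor_free X Y\<^esub> r = - r" using rels_frags by (intro inv_free_Abelian_group) (auto simp: frags_def)
    with inv show ?case by (simp add: frag_extend_minus minus rel)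
  qed (auto simp: zero rel frag_extend_add plus)
qed

lemma cls_mem: "w \<in> cls u \<longleftrightarrow> w - u \<in> null"
  unfolding tensor_class_def r_coset_def by (auto intro: bexI[of _ "w - u"])

lemma cls_eq_iff: "cls u = cls v \<longleftrightarrow> u - v \<in> null"
proof
  show "cls u = cls v \<Longrightarrow> u - v \<in> null" using cls_mem[of u u] cls_mem[of u v] null_zero by simp
  assume "u - v \<in> null"
  then show "cls u = cls v" using null_trans null_diff_commute by (auto simp: cls_mem)
qed

lemma T_carrier: "carrier T = cls ` frags"
  by (auto simp: tensor_prod_def Let_def FactGroup_def RCOSETS_def tensor_class_def frags_def)

lemma T_zero: "\<zero>\<^bsub>T\<^esub> = cls 0"
  by (auto simp: tensor_prod_def Let_def FactGroup_def cls_mem)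

lemma T_add: "cls u \<oplus>\<^bsub>T\<^esub> cls v = cls (u + v)"
proof -
  have "w \<in> cls u \<oplus>\<^bsub>T\<^esub> cls v \<longleftrightarrow> w - (u + v) \<in> null" for w
  proof
    assume "w \<in> cls u \<oplus>\<^bsub>T\<^esub> cls v"
    then obtain u' v' where "w = u' + v'" "u' - u \<in> null" "v' - v \<in> null"
      by (auto simp: tensor_prod_def Let_def FactGroup_def set_mult_def cls_mem)
    then show "w - (u + v) \<in> null" using null_add[of "u' - u" "v' - v"] by (simp add: algebra_simps)
  next
    assume w: "w - (u + v) \<in> null"
    have "w - v \<in> cls u" "v \<in> cls v" "w = (w - v) + v"
      using w null_zero by (simp_all add: cls_mem algebra_simps)
    then have "\<exists>u' \<in> cls u. \<exists>v' \<in> cls v. w = u' + v'" by blast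
    then show "w \<in> cls u \<oplus>\<^bsub>T\<^esub> cls v"
      by (simp add: tensor_prod_def Let_def FactGroup_def set_mult_def)
  qed
  note iff = this
  show ?thesis by (rule Set.set_eqI) (simp only: iff cls_mem)
qed

lemma T_abelian_group: "abelian_group T"
proof (rule abelian_groupI)
  have rep: "\<exists>u \<in> frags. Z = cls u" if "Z \<in> carrier T" for Z
    using that by (auto simp: T_carrier)
  show "\<zero>\<^bsub>T\<^esub> \<in> carrier T" by (auto simp: T_carrier T_zero intro: frags_zero)
  fix Z assume "Z \<in> carrier T"
  then obtain u where u: "u \<in> frags" "Z = cls u" using rep by blast
  then show "\<exists>Z' \<in> carrier T. Z' \<oplus>\<^bsub>T\<^esub> Z = \<zero>\<^bsub>T\<^esub>"
    using frags_uminus[OF u(1)] by (auto simp: T_carrier T_add T_zero intro!: bexI[of _ "- u"])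
  show "\<zero>\<^bsub>T\<^esub> \<oplus>\<^bsub>T\<^esub> Z = Z" using u by (simp add: T_zero T_add)
  fix Z' assume "Z' \<in> carrier T"
  then obtain u' where u': "u' \<in> frags" "Z' = cls u'" using rep by blast
  show "Z \<oplus>\<^bsub>T\<^esub> Z' \<in> carrier T" using u u' by (auto simp: T_add T_carrier intro: frags_add)
  show "Z \<oplus>\<^bsub>T\<^esub> Z' = Z' \<oplus>\<^bsub>T\<^esub> Z" using u u' by (simp add: T_add add.commute)
  fix Z'' assume "Z'' \<in> carrier T"
  then obtain u'' where u'': "u'' \<in> frags" "Z'' = cls u''" using rep by blast
  show "Z \<oplus>\<^bsub>T\<^esub> Z' \<oplus>\<^bsub>T\<^esub> Z'' = Z \<oplus>\<^bsub>T\<^esub> (Z' \<oplus>\<^bsub>T\<^esub> Z'')"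
    using u u' u'' by (simp add: T_add add.assoc)
qed

lemma T_uminus:
  assumes "u \<in> frags"
  shows "\<ominus>\<^bsub>T\<^esub> cls u = cls (- u)"
proof -
  interpret T: abelian_group T by (rule T_abelian_group)
  show ?thesis
    using assms frags_uminus[OF assms]
    by (intro T.minus_equality) (auto simp: T_add T_zero T_carrier)
qed

lemma T_finsum:
  assumes "finite I" "\<And>i. i \<in> I \<Longrightarrow> u i \<in> frags"
  shows "(\<Oplus>\<^bsub>T\<^esub>i\<in>I. cls (u i)) = cls (\<Sum>i\<in>I. u i)"
proof -
  interpret T: abelian_group T by (rule T_abelian_group)
  show ?thesis
    using assms
  proof (induction I)
    case (insert i I)
    then have "(\<Oplus>\<^bsub>T\<^esub>i\<in>insert i I. cls (u i)) = cls (u i) \<oplus>\<^bsub>T\<^esub> (\<Oplus>\<^bsub>T\<^esub>i\<in>I. cls (u i))"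
      by (intro T.finsum_insert) (auto simp: T_carrier)
    then show ?case using insert by (simp add: T_add)
  qed (simp add: T_zero)
qed

lemma T_add_pow_sign:
  assumes "u \<in> frags" "s = 1 \<or> s = -1"
  shows "add_pow T (s :: int) (cls u) = cls (frag_cmul s u)"
proof -
  interpret T: abelian_group T by (rule T_abelian_group)
  have c: "cls u \<in> carrier T" using assms(1) by (simp add: T_carrier)
  then show ?thesis
    using assms(2) T_uminus[OF assms(1)] T.add.int_pow_1[OF c] T.add.int_pow_neg[OF c, of 1]
    by auto
qed

end

lemma tensor_map_class:
  fixes g :: "'x \<Rightarrow> 'x1" and h :: "'y \<Rightarrow> 'y1"
  assumes "balanced_pair A X Y" "balanced_pair A' X' Y'"
  defines "G \<equiv> frag_extend (\<lambda>(x, y). frag_of (g x, h y))"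
  assumes G: "\<And>u. u \<in> tensor_null A X Y \<Longrightarrow> G u \<in> tensor_null A' X' Y'"
  shows "tensor_map A' X' Y' g h (tensor_class A X Y u) = tensor_class A' X' Y' (G u)"
proof -
  interpret B: balanced_pair A X Y by fact
  interpret B': balanced_pair A' X' Y' by fact
  have "B'.cls (G u') = B'.cls (G u)" if "u' \<in> B.cls u" for u'
    using G[of "u' - u"] that by (simp add: B'.cls_eq_iff B.cls_mem G_def frag_extend_diff)
  moreover have "u \<in> B.cls u" by (simp add: B.cls_mem B.null_zero)
  ultimately show ?thesis unfolding tensor_map_def G_def[symmetric] by blast
qed

section \<open>Bimodules over the symmetric algebra\<close>

lemma sym_proj_ring_hom: "sym_proj N \<in> ring_hom type_ring (sym_alg N)"
  using coset_type_ring_hom unfolding sym_proj_def[abs_def] sym_alg_def .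

lemma sym_proj_closed: "sym_proj N a \<in> carrier (sym_alg N)"
  using ring_hom_closed[OF sym_proj_ring_hom, of a] by simp

lemma sym_proj_add: "sym_proj N (a + b) = sym_proj N a \<oplus>\<^bsub>sym_alg N\<^esub> sym_proj N b"
  using ring_hom_add[OF sym_proj_ring_hom, of a b] by simp

lemma sym_proj_mult: "sym_proj N (a * b) = sym_proj N a \<otimes>\<^bsub>sym_alg N\<^esub> sym_proj N b"
  using ring_hom_mult[OF sym_proj_ring_hom, of a b] by simp

lemma scal_mult_wterm: "scal c * wterm xs d = wterm xs (c * d)"
  by (simp add: scal_wterm wterm_mult)

abbreviation lact :: "nat \<Rightarrow> (('b, 'k::field) tensor set, 'm) bimod \<Rightarrow> ('b, 'k) tensor \<Rightarrow> 'm \<Rightarrow> 'm"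
  where "lact N M v \<equiv> smult M (sym_proj N v)"

abbreviation ract :: "nat \<Rightarrow> (('b, 'k::field) tensor set, 'm) bimod \<Rightarrow> 'm \<Rightarrow> ('b, 'k) tensor \<Rightarrow> 'm"
  where "ract N M x v \<equiv> rsmult M x (sym_proj N v)"

locale sym_bim =
  fixes N :: nat and M :: "(('b, 'k::field) tensor set, 'm) bimod"
  assumes sym_bimodule: "sym_bimodule N M"
begin

sublocale bim: bimodule "sym_alg N" M
  using sym_bimodule by (simp add: sym_bimodule_def)

lemma lact_closed: "x \<in> carrier M \<Longrightarrow> lact N M v x \<in> carrier M"
  and ract_closed: "x \<in> carrier M \<Longrightarrow> ract N M x v \<in> carrier M"
  by (simp_all add: bim.smult_closed bim.rsmult_closed sym_proj_closed)

lemma lact_add_left: "x \<in> carrier M \<Longrightarrow> lact N M (v + v') x = lact N M v x \<oplus>\<^bsub>M\<^esub> lact N M v' x"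
  and ract_add_right: "x \<in> carrier M \<Longrightarrow> ract N M x (v + v') = ract N M x v \<oplus>\<^bsub>M\<^esub> ract N M x v'"
  by (simp_all add: sym_proj_add bim.smult_l_distr bim.rsmult_r_distr sym_proj_closed)

lemma lact_add_right:
    "x \<in> carrier M \<Longrightarrow> y \<in> carrier M \<Longrightarrow> lact N M v (x \<oplus>\<^bsub>M\<^esub> y) = lact N M v x \<oplus>\<^bsub>M\<^esub> lact N M v y"
  and ract_add_left:
    "x \<in> carrier M \<Longrightarrow> y \<in> carrier M \<Longrightarrow> ract N M (x \<oplus>\<^bsub>M\<^esub> y) v = ract N M x v \<oplus>\<^bsub>M\<^esub> ract N M y v"
  by (simp_all add: bim.smult_r_distr bim.rsmult_l_distr sym_proj_closed)

lemma lact_mult: "x \<in> carrier M \<Longrightarrow> lact N M (v * v') x = lact N M v (lact N M v' x)"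
  and ract_mult: "x \<in> carrier M \<Longrightarrow> ract N M x (v * v') = ract N M (ract N M x v) v'"
  by (simp_all add: sym_proj_mult bim.smult_assoc bim.rsmult_assoc sym_proj_closed)

lemma lact_ract: "x \<in> carrier M \<Longrightarrow> ract N M (lact N M v x) v' = lact N M v (ract N M x v')"
  by (simp add: bim.smult_rsmult sym_proj_closed)

lemma lact_scal: "x \<in> carrier M \<Longrightarrow> lact N M (scal c) x = ract N M x (scal c)"
  using sym_bimodule by (simp add: sym_bimodule_def)

lemma lact_scal_mult: "x \<in> carrier M \<Longrightarrow> lact N M (scal c * v) x = ract N M (lact N M v x) (scal c)"
  by (simp add: lact_mult lact_scal lact_closed)

lemma ract_scal_mult: "x \<in> carrier M \<Longrightarrow> ract N M x (scal c * v) = ract N M (ract N M x v) (scal c)"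
  by (simp add: scal_commute ract_mult)

lemma lact_ract_scal:
  "x \<in> carrier M \<Longrightarrow> lact N M v (ract N M x (scal c)) = ract N M (lact N M v x) (scal c)"
  by (simp add: lact_ract)

lemma ract_ract_scal:
  "x \<in> carrier M \<Longrightarrow> ract N M (ract N M x (scal c)) v = ract N M (ract N M x v) (scal c)"
  by (simp add: ract_scal_mult flip: ract_mult)

end

lemma abelian_group_restrict_scalars:
  assumes "abelian_group X"
  shows "abelian_group (restrict_scalars h X)"
proof -
  interpret X: abelian_group X by fact
  show ?thesis
    by (rule abelian_groupI)
      (auto simp: restrict_scalars_def X.a_ac intro: X.l_neg)
qed

lemma over_k_simps [simp]:
  "carrier (over_k N X) = carrier X" "zero (over_k N X) = zero X" "add (over_k N X) = add X"
  "rsmult (over_k N X) x c = rsmult X x (sym_proj N (scal c))"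
  "smult (over_k N X) c x = smult X (sym_proj N (scal c)) x"
  by (simp_all add: restrict_scalars_def)

lemma tensor_bimod_simps [simp]:
  "carrier tensor_bimod = UNIV" "zero tensor_bimod = 0" "add tensor_bimod = (+)"
  "smult tensor_bimod c a = scal c * a"
  by (simp_all add: tensor_bimod_def)

lemma ext_pow_simps [simp]:
  "carrier (ext_pow r) = ext_proj ` tens_pow r" "zero (ext_pow r) = zero ext_alg"
  "add (ext_pow r) = add ext_alg" "smult (ext_pow r) c Y = ext_proj (scal c) \<otimes>\<^bsub>ext_alg\<^esub> Y"
  by (simp_all add: ext_pow_def)

lemma abelian_group_tensor_bimod: "abelian_group tensor_bimod"
  by (rule abelian_groupI) (auto simp: algebra_simps intro: exI[of _ "- _"])

lemma ext_proj_zero: "ext_proj 0 = \<zero>\<^bsub>ext_alg\<^esub>"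
proof -
  interpret ring_hom_ring type_ring ext_alg ext_proj
    using ideal.quotient_is_ring[OF ideal_Idl_type_ring] ext_proj_ring_hom
    by (intro ring_hom_ringI2 ring_type_ring) (auto simp: ext_alg_def ext_null_def)
  show ?thesis using hom_zero by simp
qed

lemma abelian_group_ext_pow: "abelian_group (ext_pow r :: ('k::field, ('b, 'k) tensor set) bimod)"
  (is "abelian_group ?E")
proof (rule abelian_groupI)
  show "\<zero>\<^bsub>?E\<^esub> \<in> carrier ?E" using tens_pow_zero[of r] by (auto simp flip: ext_proj_zero)
  fix Z assume "Z \<in> carrier ?E"
  then obtain z where z: "z \<in> tens_pow r" "Z = ext_proj z" by auto
  show "\<zero>\<^bsub>?E\<^esub> \<oplus>\<^bsub>?E\<^esub> Z = Z" using z by (simp flip: ext_proj_add ext_proj_zero)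
  show "\<exists>Y \<in> carrier ?E. Y \<oplus>\<^bsub>?E\<^esub> Z = \<zero>\<^bsub>?E\<^esub>"
    using z tens_pow_uminus[OF z(1)]
    by (auto simp flip: ext_proj_add ext_proj_zero intro!: bexI[of _ "- z"])
  fix Y assume "Y \<in> carrier ?E"
  then obtain y where y: "y \<in> tens_pow r" "Y = ext_proj y" by auto
  show "Z \<oplus>\<^bsub>?E\<^esub> Y \<in> carrier ?E" "Z \<oplus>\<^bsub>?E\<^esub> Y = Y \<oplus>\<^bsub>?E\<^esub> Z"
    using z y tens_pow_add[of z r y] by (auto simp add: add.commute simp flip: ext_proj_add)
  fix X assume "X \<in> carrier ?E"
  then obtain x where x: "x \<in> tens_pow r" "X = ext_proj x" by auto
  show "Z \<oplus>\<^bsub>?E\<^esub> Y \<oplus>\<^bsub>?E\<^esub> X = Z \<oplus>\<^bsub>?E\<^esub> (Y \<oplus>\<^bsub>?E\<^esub> X)"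
    using x y z by (simp add: add.assoc flip: ext_proj_add)
qed

lemma balanced_pair_tensor_bimod:
  assumes "abelian_group X" "\<And>x c. x \<in> carrier X \<Longrightarrow> rsmult X x (sym_proj N (scal c)) \<in> carrier X"
  shows "balanced_pair type_ring (over_k N X) tensor_bimod"
  using assms by (intro balanced_pair.intro)
    (auto intro: abelian_group_restrict_scalars abelian_group_tensor_bimod)

lemma balanced_pair_ext_pow:
  assumes "abelian_group X" "\<And>x c. x \<in> carrier X \<Longrightarrow> rsmult X x (sym_proj N (scal c)) \<in> carrier X"
  shows "balanced_pair type_ring (over_k N X) (ext_pow r)"
  using assms by (intro balanced_pair.intro)
    (auto intro: abelian_group_restrict_scalars abelian_group_ext_pow tens_pow_scal_mult simp flip: ext_proj_mult)

lemma chain_of_ext_class: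
  fixes X :: "(('b, 'k::field) tensor set, 'm) bimod"
  assumes X: "abelian_group X" "\<And>x c. x \<in> carrier X \<Longrightarrow> rsmult X x (sym_proj N (scal c)) \<in> carrier X"
  shows "chain_of_ext N X r (tensor_class type_ring (over_k N X) (ext_pow r) u) =
    tensor_class type_ring (over_k N X) tensor_bimod
      (frag_extend (\<lambda>(x, Y). frag_of (x, ext_phi r Y)) u)"
proof -
  interpret E: balanced_pair type_ring "over_k N X" "ext_pow r :: ('k, ('b, 'k) tensor set) bimod"
    by (rule balanced_pair_ext_pow[OF X])
  interpret B: balanced_pair type_ring "over_k N X" "tensor_bimod :: ('k, ('b, 'k) tensor) bimod"
    by (rule balanced_pair_tensor_bimod[OF X])
  have "frag_extend (\<lambda>(x, Y). frag_of (id x, ext_phi r Y)) u \<in> B.null" if "u \<in> E.null" for u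
    using B.null_zero B.null_add B.null_uminus _ _ _ that
  proof (rule E.null_extend)
    fix x x' Y assume "x \<in> carrier (over_k N X)" "x' \<in> carrier (over_k N X)" "Y \<in> carrier (ext_pow r :: ('k, ('b, 'k) tensor set) bimod)"
    then show "(case (x \<oplus>\<^bsub>over_k N X\<^esub> x', Y) of (x, Y) \<Rightarrow> frag_of (id x, ext_phi r Y)) -
      ((case (x, Y) of (x, Y) \<Rightarrow> frag_of (id x, ext_phi r Y)) +
       (case (x', Y) of (x, Y) \<Rightarrow> frag_of (id x, ext_phi r Y))) \<in> B.null"
      using B.null_add_left[of x x' "ext_phi r Y"] by simp
  next
    fix x and Y Y' :: "('b, 'k) tensor set"
    assume x: "x \<in> carrier (over_k N X)" and "Y \<in> carrier (ext_pow r :: ('k, ('b, 'k) tensor set) bimod)" "Y' \<in> carrier (ext_pow r :: ('k, ('b, 'k) tensor set) bimod)"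
    then obtain y y' where "y \<in> tens_pow r" "Y = ext_proj y" "y' \<in> tens_pow r" "Y' = ext_proj y'" by auto
    then show "(case (x, Y \<oplus>\<^bsub>ext_pow r\<^esub> Y') of (x, Y) \<Rightarrow> frag_of (id x, ext_phi r Y)) -
      ((case (x, Y) of (x, Y) \<Rightarrow> frag_of (id x, ext_phi r Y)) +
       (case (x, Y') of (x, Y) \<Rightarrow> frag_of (id x, ext_phi r Y))) \<in> B.null"
      using B.null_add_right[of x "Ant r y" "Ant r y'"] x
      by (simp add: ext_phi_ext_proj tens_pow_add Ant_add flip: ext_proj_add)
  next
    fix x Y and c :: 'k
    assume x: "x \<in> carrier (over_k N X)" and "Y \<in> carrier (ext_pow r :: ('k, ('b, 'k) tensor set) bimod)"
    then obtain y where "y \<in> tens_pow r" "Y = ext_proj y" by auto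
    then show "(case (rsmult (over_k N X) x c, Y) of (x, Y) \<Rightarrow> frag_of (id x, ext_phi r Y)) -
      (case (x, smult (ext_pow r) c Y) of (x, Y) \<Rightarrow> frag_of (id x, ext_phi r Y)) \<in> B.null"
      using B.null_balanced[of x c "Ant r y"] x
      by (simp add: ext_phi_ext_proj tens_pow_scal_mult Ant_scal flip: ext_proj_mult)
  qed
  from tensor_map_class[OF E.balanced_pair_axioms B.balanced_pair_axioms this]
  show ?thesis by (simp add: chain_of_ext_def id_def)
qed

section \<open>The cap product is well defined\<close>

text \<open>
  The linear map \<open>F\<close> is meant to extend a cochain from \<open>W\<^sub>b\<close> to all tensors.  Then \<open>v F(w)\<close> makes sense
  for every \<open>w\<close>, and linearity in \<open>w\<close> can be used to reduce to words, which need not lie in \<open>W\<^sub>b\<close>.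
\<close>

locale cap_data =
  M: sym_bim N M + P: sym_bim N P
  for N :: nat and M :: "(('b, 'k::field) tensor set, 'm) bimod"
    and P :: "(('b, 'k) tensor set, 'p) bimod" +
  fixes F :: "('b, 'k) tensor \<Rightarrow> 'p"
  assumes F_closed: "F w \<in> carrier P"
    and F_add: "F (w + w') = F w \<oplus>\<^bsub>P\<^esub> F w'"
    and F_scal: "F (scal c * w) = lact N P (scal c) (F w)"
begin

abbreviation PM :: "(('b, 'k) tensor set, ('p \<times> 'm \<Rightarrow>\<^sub>0 int) set) bimod"
  where "PM \<equiv> tensor_prod (sym_alg N) P M"

sublocale PM: balanced_pair "sym_alg N" P M
  by (intro balanced_pair.intro)
    (auto intro: P.bim.abelian_group M.bim.abelian_group P.bim.rsmult_closed M.bim.smult_closed)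

sublocale CM: balanced_pair type_ring "over_k N M" "tensor_bimod :: ('k, ('b, 'k) tensor) bimod"
  by (rule balanced_pair_tensor_bimod) (auto intro: M.bim.abelian_group M.ract_closed)

abbreviation ptens :: "'p \<Rightarrow> 'm \<Rightarrow> ('p \<times> 'm \<Rightarrow>\<^sub>0 int) set"
  where "ptens \<equiv> tens (sym_alg N) P M"

lemma ptens_closed: "p \<in> carrier P \<Longrightarrow> x \<in> carrier M \<Longrightarrow> ptens p x \<in> carrier PM"
  by (simp add: tens_def PM.T_carrier PM.frags_of)

lemma ptens_add_left: "p \<in> carrier P \<Longrightarrow> p' \<in> carrier P \<Longrightarrow> x \<in> carrier M \<Longrightarrow>
    ptens (p \<oplus>\<^bsub>P\<^esub> p') x = ptens p x \<oplus>\<^bsub>PM\<^esub> ptens p' x"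
  by (simp add: tens_def PM.T_add PM.cls_eq_iff PM.null_add_left)

lemma ptens_add_right: "p \<in> carrier P \<Longrightarrow> x \<in> carrier M \<Longrightarrow> x' \<in> carrier M \<Longrightarrow>
    ptens p (x \<oplus>\<^bsub>M\<^esub> x') = ptens p x \<oplus>\<^bsub>PM\<^esub> ptens p x'"
  by (simp add: tens_def PM.T_add PM.cls_eq_iff PM.null_add_right)

lemma ptens_balanced: "p \<in> carrier P \<Longrightarrow> x \<in> carrier M \<Longrightarrow>
    ptens (ract N P p v) x = ptens p (lact N M v x)"
  by (simp add: tens_def PM.cls_eq_iff PM.null_balanced sym_proj_closed)

lemma rsmult_PM_cls: "rsmult PM (PM.cls u) (sym_proj N v) =
    PM.cls (frag_extend (\<lambda>(p, x). frag_of (p, ract N M x v)) u)"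
proof -
  have "frag_extend (\<lambda>(p, x). frag_of (id p, ract N M x v)) u \<in> PM.null" if "u \<in> PM.null" for u
    using PM.null_zero PM.null_add PM.null_uminus _ _ _ that
  proof (rule PM.null_extend)
    fix p x and a :: "('b, 'k) tensor set"
    assume p: "p \<in> carrier P" and a: "a \<in> carrier (sym_alg N)" and x: "x \<in> carrier M"
    then show "(case (rsmult P p a, x) of (p, x) \<Rightarrow> frag_of (id p, ract N M x v)) -
      (case (p, smult M a x) of (p, x) \<Rightarrow> frag_of (id p, ract N M x v)) \<in> PM.null"
      using PM.null_balanced[OF p a M.ract_closed[OF x]]
      by (simp add: M.bim.smult_rsmult sym_proj_closed)
  qed (simp_all add: PM.null_add_left PM.null_add_right M.ract_closed M.ract_add_left)
  from tensor_map_class[OF PM.balanced_pair_axioms PM.balanced_pair_axioms this]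
  show ?thesis by (simp add: tensor_prod_def Let_def id_def)
qed

lemma rsmult_PM_closed: "K \<in> carrier PM \<Longrightarrow> rsmult PM K (sym_proj N v) \<in> carrier PM"
proof -
  assume "K \<in> carrier PM"
  then obtain u where u: "u \<in> PM.frags" "K = PM.cls u" by (auto simp: PM.T_carrier)
  have "frag_extend (\<lambda>(p, x). frag_of (p, ract N M x v)) u \<in> PM.frags"
    using keys_frag_extend[of "\<lambda>(p, x). frag_of (p, ract N M x v)" u] u(1) M.ract_closed
    by (fastforce simp: PM.frags_def keys_frag_of split: prod.splits)
  then show ?thesis by (simp add: u(2) rsmult_PM_cls PM.T_carrier)
qed

lemma rsmult_ptens: "rsmult PM (ptens p x) (sym_proj N v) = ptens p (ract N M x v)"
  by (simp add: tens_def rsmult_PM_cls)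

text \<open>
  Scalars act centrally on both bimodules, so they can be moved across the tensor sign in either
  direction.
\<close>

lemma ptens_scal_left: "p \<in> carrier P \<Longrightarrow> x \<in> carrier M \<Longrightarrow>
    ptens (ract N P p (scal c)) x = rsmult PM (ptens p x) (sym_proj N (scal c))"
  by (simp add: ptens_balanced rsmult_ptens M.lact_scal)

sublocale CPM: balanced_pair type_ring "over_k N PM" "tensor_bimod :: ('k, ('b, 'k) tensor) bimod"
  by (rule balanced_pair_tensor_bimod) (auto intro: PM.T_abelian_group rsmult_PM_closed)

definition cap_coeff :: "'m \<Rightarrow> ('b, 'k) tensor \<Rightarrow> ('b, 'k) tensor \<Rightarrow> ('b, 'k) tensor \<Rightarrow> ('b, 'k) tensor \<Rightarrow>
    ('p \<times> 'm \<Rightarrow>\<^sub>0 int) set"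
  where "cap_coeff m u v w s = ptens (lact N P v (F w)) (ract N M (lact N M s m) u)"

lemmas act_closed = F_closed P.lact_closed P.ract_closed M.lact_closed M.ract_closed

context
  fixes m assumes m: "m \<in> carrier M"
begin

lemma cap_coeff_closed: "cap_coeff m u v w s \<in> carrier PM"
  using m by (simp add: cap_coeff_def ptens_closed act_closed)

lemma cap_coeff_add:
  shows cap_coeff_add_u: "cap_coeff m (u + u') v w s = cap_coeff m u v w s \<oplus>\<^bsub>PM\<^esub> cap_coeff m u' v w s"
    and cap_coeff_add_v: "cap_coeff m u (v + v') w s = cap_coeff m u v w s \<oplus>\<^bsub>PM\<^esub> cap_coeff m u v' w s"
    and cap_coeff_add_w: "cap_coeff m u v (w + w') s = cap_coeff m u v w s \<oplus>\<^bsub>PM\<^esub> cap_coeff m u v w' s"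
    and cap_coeff_add_s: "cap_coeff m u v w (s + s') = cap_coeff m u v w s \<oplus>\<^bsub>PM\<^esub> cap_coeff m u v w s'"
  using m by (simp_all add: cap_coeff_def act_closed ptens_add_left ptens_add_right F_add M.lact_add_left
      P.lact_add_left P.lact_add_right M.ract_add_left M.ract_add_right)

lemma cap_coeff_scal:
  shows cap_coeff_scal_m: "cap_coeff (ract N M m (scal c)) u v w s = rsmult PM (cap_coeff m u v w s) (sym_proj N (scal c))"
    and cap_coeff_scal_u: "cap_coeff m (scal c * u) v w s = rsmult PM (cap_coeff m u v w s) (sym_proj N (scal c))"
    and cap_coeff_scal_v: "cap_coeff m u (scal c * v) w s = rsmult PM (cap_coeff m u v w s) (sym_proj N (scal c))"
    and cap_coeff_scal_w: "cap_coeff m u v (scal c * w) s = rsmult PM (cap_coeff m u v w s) (sym_proj N (scal c))"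
    and cap_coeff_scal_s: "cap_coeff m u v w (scal c * s) = rsmult PM (cap_coeff m u v w s) (sym_proj N (scal c))"
  using m by (simp_all add: cap_coeff_def act_closed F_scal M.lact_scal_mult P.lact_scal_mult P.lact_scal
      M.ract_scal_mult M.lact_ract_scal P.lact_ract_scal M.ract_ract_scal ptens_scal_left rsmult_ptens)

end

lemma cap_coeff_add_m: "m \<in> carrier M \<Longrightarrow> m' \<in> carrier M \<Longrightarrow>
    cap_coeff (m \<oplus>\<^bsub>M\<^esub> m') u v w s = cap_coeff m u v w s \<oplus>\<^bsub>PM\<^esub> cap_coeff m' u v w s"
  by (simp add: cap_coeff_def act_closed M.lact_add_right M.ract_add_left ptens_add_right)

end

lemma tens_pow_additive_induct [consumes 1, case_names wterm add]:
  fixes x :: "('b, 'k::field) tensor"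
  assumes "x \<in> tens_pow r" "\<And>xs c. length xs = r \<Longrightarrow> P (wterm xs c)"
    "\<And>a b. P a \<Longrightarrow> P b \<Longrightarrow> P (a + b)"
  shows "P x"
  using assms(1)
proof (induction x rule: tens_pow_induct)
  case zero
  show ?case using assms(2)[of "replicate r undefined" 0] by simp
qed (use assms in auto)

text \<open>
  The words of a tensor of degree \<open>i + a + l + b + j\<close> are cut into five pieces of these lengths.
  This gives a cap product on all of \<open>M \<otimes> T(V)\<close>, hence independence of the way in which a
  chain is written.
\<close>

locale cap_split = cap_data N M P F
  for N :: nat and M :: "(('b, 'k::field) tensor set, 'm) bimod"
    and P :: "(('b, 'k) tensor set, 'p) bimod" and F :: "('b, 'k) tensor \<Rightarrow> 'p" +
  fixes i a l b j :: nat
begin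

definition piece :: "'m \<Rightarrow> 'b list \<Rightarrow> 'k \<Rightarrow> (('p \<times> 'm \<Rightarrow>\<^sub>0 int) set \<times> ('b, 'k) tensor) \<Rightarrow>\<^sub>0 int"
  where "piece m xs c = frag_of
    (cap_coeff m (wterm (take i xs) 1) (wterm (take l (drop (i + a) xs)) 1)
      (wterm (take b (drop (i + a + l) xs)) 1) (wterm (drop (i + a + l + b) xs) 1),
     wterm (take a (drop i xs)) c)"

definition cut :: "'m \<times> ('b, 'k) tensor \<Rightarrow> (('p \<times> 'm \<Rightarrow>\<^sub>0 int) set \<times> ('b, 'k) tensor) \<Rightarrow>\<^sub>0 int"
  where "cut = (\<lambda>(m, t). \<Sum>w\<in>Poly_Mapping.keys t. piece m (letters w) (Poly_Mapping.lookup t w))"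

context
  fixes m assumes m: "m \<in> carrier M"
begin

lemma piece_add: "piece m xs (c + d) - (piece m xs c + piece m xs d) \<in> CPM.null"
  unfolding piece_def
  using CPM.null_add_right[of _ "wterm (take a (drop i xs)) c" "wterm (take a (drop i xs)) d"] cap_coeff_closed[OF m]
  by (simp add: single_add)

lemma cut_superset:
  assumes "finite K" "Poly_Mapping.keys t \<subseteq> K"
  shows "cut (m, t) - (\<Sum>w\<in>K. piece m (letters w) (Poly_Mapping.lookup t w)) \<in> CPM.null"
proof -
  have zero: "piece m xs 0 \<in> CPM.null" for xs
    using CPM.null_zero_right[of "cap_coeff m (wterm (take i xs) 1) (wterm (take l (drop (i + a) xs)) 1)
      (wterm (take b (drop (i + a + l) xs)) 1) (wterm (drop (i + a + l + b) xs) 1)"] cap_coeff_closed[OF m]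
    by (simp add: piece_def)
  have "(\<Sum>w\<in>K - Poly_Mapping.keys t. piece m (letters w) (Poly_Mapping.lookup t w)) \<in> CPM.null"
    by (rule CPM.null_sum) (simp add: in_keys_iff zero)
  moreover have "(\<Sum>w\<in>K. piece m (letters w) (Poly_Mapping.lookup t w)) =
    (\<Sum>w\<in>K - Poly_Mapping.keys t. piece m (letters w) (Poly_Mapping.lookup t w)) + cut (m, t)"
    unfolding cut_def by (simp add: sum.subset_diff[OF assms(2,1)])
  ultimately show ?thesis using CPM.null_uminus by fastforce
qed

lemma cut_add: "cut (m, t + t') - (cut (m, t) + cut (m, t')) \<in> CPM.null"
proof -
  let ?K = "Poly_Mapping.keys t \<union> Poly_Mapping.keys t'"
  let ?S = "\<lambda>t. \<Sum>w\<in>?K. piece m (letters w) (Poly_Mapping.lookup t w)"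
  have fin: "finite ?K" by simp
  have "?S (t + t') - (?S t + ?S t') = (\<Sum>w\<in>?K. piece m (letters w) (Poly_Mapping.lookup t w + Poly_Mapping.lookup t' w) -
     (piece m (letters w) (Poly_Mapping.lookup t w) + piece m (letters w) (Poly_Mapping.lookup t' w)))"
    by (simp add: lookup_add sum_subtractf sum.distrib)
  also have "\<dots> \<in> CPM.null" by (intro CPM.null_sum piece_add)
  finally have 0: "?S (t + t') - (?S t + ?S t') \<in> CPM.null" .
  have 1: "cut (m, t + t') - ?S (t + t') \<in> CPM.null" using cut_superset[OF fin keys_add] .
  have 2: "cut (m, t) - ?S t \<in> CPM.null" "cut (m, t') - ?S t' \<in> CPM.null"
    using cut_superset[OF fin] by auto
  have "cut (m, t + t') - (cut (m, t) + cut (m, t')) =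
    (cut (m, t + t') - ?S (t + t')) + (?S (t + t') - (?S t + ?S t')) -
    ((cut (m, t) - ?S t) + (cut (m, t') - ?S t'))" by (simp only: algebra_simps)
  then show ?thesis
    using CPM.null_diff[OF CPM.null_add[OF 1 0] CPM.null_add[OF 2]] by simp
qed

lemma cut_balanced: "cut (ract N M m (scal c), t) - cut (m, scal c * t) \<in> CPM.null"
proof -
  let ?K = "Poly_Mapping.keys t"
  let ?S = "\<Sum>w\<in>?K. piece m (letters w) (Poly_Mapping.lookup (scal c * t) w)"
  have "Poly_Mapping.lookup (scal c * t) w = c * Poly_Mapping.lookup t w" for w
    using cf_scal_mult[of c t "letters w"] by simp
  then have keys: "Poly_Mapping.keys (scal c * t) \<subseteq> ?K"
    and S: "?S = (\<Sum>w\<in>?K. piece m (letters w) (c * Poly_Mapping.lookup t w))"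
    by (auto simp: in_keys_iff)
  have piece: "piece (ract N M m (scal c)) xs d - piece m xs (c * d) \<in> CPM.null" for xs d
    unfolding piece_def cap_coeff_scal_m[OF m]
    using CPM.null_balanced[of _ c "wterm (take a (drop i xs)) d"] cap_coeff_closed[OF m]
    by (simp add: scal_mult_wterm)
  have "cut (ract N M m (scal c), t) - ?S \<in> CPM.null"
    unfolding S cut_def prod.case sum_subtractf[symmetric] by (intro CPM.null_sum piece)
  then show ?thesis
    using CPM.null_trans CPM.null_diff_commute cut_superset[OF finite_keys keys] by blast
qed

text \<open>
  Both sides are additive in each of the five factors, so these may be taken to be multiples of words.
  For words the cut is the given one, and the scalars are collected in the factor \<open>y\<close>.
\<close>

lemma cut_product:
  assumes "u \<in> tens_pow i" "y \<in> tens_pow a" "v \<in> tens_pow l" "w \<in> tens_pow b" "s \<in> tens_pow j"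
  shows "cut (m, u * y * v * w * s) - frag_of (cap_coeff m u v w s, y) \<in> CPM.null"
proof -
  let ?E = "\<lambda>u y v w s. cut (m, u * y * v * w * s) - frag_of (cap_coeff m u v w s, y) \<in> CPM.null"
  have glue: "cut (m, t + t') - frag_of (z, y) \<in> CPM.null"
    if "cut (m, t) - frag_of (z1, y1) \<in> CPM.null" "cut (m, t') - frag_of (z2, y2) \<in> CPM.null"
      and z: "frag_of (z, y) - (frag_of (z1, y1) + frag_of (z2, y2)) \<in> CPM.null" for t t' z y z1 y1 z2 y2
  proof -
    have eq: "cut (m, t + t') - frag_of (z, y) = (cut (m, t + t') - (cut (m, t) + cut (m, t'))) +
      ((cut (m, t) - frag_of (z1, y1)) + (cut (m, t') - frag_of (z2, y2))) -
      (frag_of (z, y) - (frag_of (z1, y1) + frag_of (z2, y2)))" by (simp only: algebra_simps)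
    show ?thesis
      unfolding eq by (rule CPM.null_diff[OF CPM.null_add[OF cut_add CPM.null_add[OF that(1,2)]] z])
  qed
  note cap_coeff_rel = CPM.null_add_left[of "cap_coeff m _ _ _ _" "cap_coeff m _ _ _ _", simplified, OF cap_coeff_closed[OF m] cap_coeff_closed[OF m]]
  show ?thesis
    using assms(1)
  proof (induction u rule: tens_pow_additive_induct)
    case (add u u')
    show ?case unfolding distrib_right cap_coeff_add_u[OF m] by (rule glue[OF add.IH cap_coeff_rel])
  next
    case (wterm us cu)
    show ?case
      using assms(2)
    proof (induction y rule: tens_pow_additive_induct)
      case (add y y')
      show ?case unfolding distrib_left distrib_right
        by (rule glue[OF add.IH]) (use CPM.null_add_right[of _ y y'] cap_coeff_closed[OF m] in simp)
    next
      case (wterm ys cy)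
      show ?case
        using assms(3)
      proof (induction v rule: tens_pow_additive_induct)
        case (add v v')
        show ?case unfolding distrib_left distrib_right cap_coeff_add_v[OF m] by (rule glue[OF add.IH cap_coeff_rel])
      next
        case (wterm vs cv)
        show ?case
          using assms(4)
        proof (induction w rule: tens_pow_additive_induct)
          case (add w w')
          show ?case unfolding distrib_left distrib_right cap_coeff_add_w[OF m] by (rule glue[OF add.IH cap_coeff_rel])
        next
          case (wterm ws cw)
          show ?case
            using assms(5)
          proof (induction s rule: tens_pow_additive_induct)
            case (add s s')
            show ?case unfolding distrib_left cap_coeff_add_s[OF m] by (rule glue[OF add.IH cap_coeff_rel])
          next
            case (wterm ss cs)
            let ?z = "cap_coeff m (wterm us 1) (wterm vs 1) (wterm ws 1) (wterm ss 1)"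
            let ?xs = "us @ ys @ vs @ ws @ ss" and ?c = "cu * cy * cv * cw * cs"
            have c: "wterm zs d = scal d * wterm zs 1" for zs :: "'b list" and d :: 'k
              by (simp add: scal_wterm wterm_mult)
            have move: "frag_of (rsmult PM z (sym_proj N (scal d)), y) - frag_of (z, scal d * y) \<in> CPM.null"
              if "z \<in> carrier PM" for z d y
              using CPM.null_balanced[of z d y] that by simp
            have "piece m ?xs ?c = frag_of (?z, wterm ys ?c)"
              using \<open>length us = i\<close> \<open>length ys = a\<close> \<open>length vs = l\<close> \<open>length ws = b\<close>
              by (simp add: piece_def)
            moreover have "cut (m, wterm ?xs ?c) - piece m ?xs ?c \<in> CPM.null"
              using cut_superset[of "{Word ?xs}" "wterm ?xs ?c"] by simp
            ultimately have 1: "cut (m, wterm ?xs ?c) - frag_of (?z, wterm ys ?c) \<in> CPM.null" by simp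
            let ?zu = "rsmult PM ?z (sym_proj N (scal cu))"
            let ?zv = "rsmult PM ?zu (sym_proj N (scal cv))"
            let ?zw = "rsmult PM ?zv (sym_proj N (scal cw))"
            let ?zs = "rsmult PM ?zw (sym_proj N (scal cs))"
            have zs: "cap_coeff m (wterm us cu) (wterm vs cv) (wterm ws cw) (wterm ss cs) = ?zs"
              unfolding c[of us cu] c[of vs cv] c[of ws cw] c[of ss cs] cap_coeff_scal_s[OF m] cap_coeff_scal_w[OF m] cap_coeff_scal_v[OF m] cap_coeff_scal_u[OF m] ..
            have carr: "?z \<in> carrier PM" "?zu \<in> carrier PM" "?zv \<in> carrier PM" "?zw \<in> carrier PM"
              by (simp_all add: cap_coeff_closed[OF m] rsmult_PM_closed)
            have "frag_of (?zs, wterm ys cy) - frag_of (?z, scal cu * (scal cv * (scal cw * (scal cs * wterm ys cy)))) \<in> CPM.null"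
              by (rule CPM.null_trans[OF move[OF carr(4)] CPM.null_trans[OF move[OF carr(3)]
                  CPM.null_trans[OF move[OF carr(2)] move[OF carr(1)]]]])
            also have "scal cu * (scal cv * (scal cw * (scal cs * wterm ys cy))) = wterm ys ?c"
              by (simp add: scal_wterm wterm_mult mult_ac)
            finally have 2: "frag_of (?z, wterm ys ?c) - frag_of (?zs, wterm ys cy) \<in> CPM.null"
              using CPM.null_diff_commute by blast
            show ?case unfolding zs using CPM.null_trans[OF 1 2] by (simp add: wterm_mult mult.assoc)
          qed
        qed
      qed
    qed
  qed
qed

end

lemma cut_null:
  assumes "u \<in> CM.null"
  shows "frag_extend cut u \<in> CPM.null"
  using CPM.null_zero CPM.null_add CPM.null_uminus _ _ _ assms
proof (rule CM.null_extend)
  fix m m' t assume "m \<in> carrier (over_k N M)" "m' \<in> carrier (over_k N M)"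
  then have m: "m \<in> carrier M" "m' \<in> carrier M" by simp_all
  have "piece (m \<oplus>\<^bsub>M\<^esub> m') xs c - (piece m xs c + piece m' xs c) \<in> CPM.null" for xs c
    unfolding piece_def cap_coeff_add_m[OF m]
    using CPM.null_add_left[of "cap_coeff m _ _ _ _" "cap_coeff m' _ _ _ _"] cap_coeff_closed[OF m(1)] cap_coeff_closed[OF m(2)] by simp
  then have "(\<Sum>w\<in>Poly_Mapping.keys t. piece (m \<oplus>\<^bsub>M\<^esub> m') (letters w) (Poly_Mapping.lookup t w) -
     (piece m (letters w) (Poly_Mapping.lookup t w) + piece m' (letters w) (Poly_Mapping.lookup t w))) \<in> CPM.null"
    by (intro CPM.null_sum)
  then show "cut (m \<oplus>\<^bsub>over_k N M\<^esub> m', t) - (cut (m, t) + cut (m', t)) \<in> CPM.null"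
    by (simp add: cut_def sum_subtractf sum.distrib)
qed (use cut_add cut_balanced in auto)

text \<open>
  Every presentation of a chain that the inductive definition allows computes the same additive map.
\<close>

lemma cap_graph_cut:
  assumes "(z, t) \<in> cap_graph N M P f i a l b j"
    and f: "\<And>w. w \<in> W N b \<Longrightarrow> f w = F w"
  shows "\<exists>u. z = CM.cls u \<and> t = CPM.cls (frag_extend cut u)"
  using assms(1)
proof (induction z t rule: cap_graph.induct)
  case zero
  show ?case by (rule exI[of _ 0]) (simp add: chain_space_def CM.T_zero CPM.T_zero)
next
  case (add z t m u y v w s)
  then obtain z' where z': "z = CM.cls z'" "t = CPM.cls (frag_extend cut z')" by blast
  have W: "y \<in> tens_pow a" "w \<in> tens_pow b" using add.hyps by (simp_all add: W_def)
  show ?case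
  proof (intro exI[of _ "z' + frag_of (m, u * y * v * w * s)"] conjI)
    show "z \<oplus>\<^bsub>chain_space N M\<^esub> chain_tens N M m (u * y * v * w * s) =
        CM.cls (z' + frag_of (m, u * y * v * w * s))"
      by (simp add: z' chain_space_def chain_tens_def tens_def CM.T_add)
    have "CPM.cls (cut (m, u * y * v * w * s)) = CPM.cls (frag_of (cap_coeff m u v w s, y))"
      unfolding CPM.cls_eq_iff using add.hyps W by (intro cut_product)
    then show "t \<oplus>\<^bsub>chain_space N PM\<^esub> chain_tens N PM
          (ptens (lact N P v (f w)) (ract N M (lact N M s m) u)) y =
        CPM.cls (frag_extend cut (z' + frag_of (m, u * y * v * w * s)))"
      using add.hyps
      by (simp add: z' f chain_space_def chain_tens_def tens_def[of type_ring] frag_extend_add cap_coeff_def flip: CPM.T_add)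
  qed
qed

lemma cap_term_eq:
  assumes t: "(z, t) \<in> cap_graph N M P f i a l b j"
    and f: "\<And>w. w \<in> W N b \<Longrightarrow> f w = F w"
  shows "cap_term N M P f i a l b j z = t"
  unfolding cap_term_def
proof (rule the_equality)
  show "(z, t) \<in> cap_graph N M P f i a l b j" by (rule t)
  fix t' assume "(z, t') \<in> cap_graph N M P f i a l b j"
  from cap_graph_cut[OF this f] cap_graph_cut[OF t f] obtain u u' where
    u: "z = CM.cls u'" "t' = CPM.cls (frag_extend cut u')" "z = CM.cls u" "t = CPM.cls (frag_extend cut u)"
    by blast
  then have "u' - u \<in> CM.null" by (metis CM.cls_eq_iff)
  from cut_null[OF this] show "t' = t" by (simp add: u CPM.cls_eq_iff frag_extend_diff)
qed

end

section \<open>The cap product in terms of the exterior algebra\<close>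

context cap_split
begin

lemma cap_graph_sum:
  assumes f: "\<And>w. w \<in> W N b \<Longrightarrow> f w = F w" and m: "m \<in> carrier M" and "finite S"
    and mem: "\<And>\<sigma>. \<sigma> \<in> S \<Longrightarrow> u \<sigma> \<in> tens_pow i \<and> y \<sigma> \<in> W N a \<and> v \<sigma> \<in> tens_pow l \<and>
      w \<sigma> \<in> W N b \<and> s \<sigma> \<in> tens_pow j"
  shows "(CM.cls (frag_of (m, \<Sum>\<sigma>\<in>S. u \<sigma> * y \<sigma> * v \<sigma> * w \<sigma> * s \<sigma>)),
     CPM.cls (\<Sum>\<sigma>\<in>S. frag_of (cap_coeff m (u \<sigma>) (v \<sigma>) (w \<sigma>) (s \<sigma>), y \<sigma>))) \<in> cap_graph N M P f i a l b j"
  using assms(3) mem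
proof (induction S)
  case empty
  have "CM.cls (frag_of (m, 0)) = CM.cls 0"
    using CM.null_zero_right[of m] m by (simp add: CM.cls_eq_iff)
  then show ?case
    using cap_graph.zero[of N M P f i a l b j] by (simp add: chain_space_def CM.T_zero CPM.T_zero)
next
  case (insert \<sigma> S)
  let ?x = "\<Sum>\<sigma>\<in>S. u \<sigma> * y \<sigma> * v \<sigma> * w \<sigma> * s \<sigma>" and ?x' = "u \<sigma> * y \<sigma> * v \<sigma> * w \<sigma> * s \<sigma>"
  have "CM.cls (frag_of (m, ?x' + ?x)) = CM.cls (frag_of (m, ?x) + frag_of (m, ?x'))"
    unfolding CM.cls_eq_iff using CM.null_add_right[of m ?x ?x'] m by (simp add: add.commute)
  moreover have "(CM.cls (frag_of (m, ?x)),
     CPM.cls (\<Sum>\<sigma>\<in>S. frag_of (cap_coeff m (u \<sigma>) (v \<sigma>) (w \<sigma>) (s \<sigma>), y \<sigma>))) \<in> cap_graph N M P f i a l b j"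
    using insert by blast
  from cap_graph.add[OF this m, of "u \<sigma>" "y \<sigma>" "v \<sigma>" "w \<sigma>" "s \<sigma>"]
  have "(CM.cls (frag_of (m, ?x) + frag_of (m, ?x')),
     CPM.cls ((\<Sum>\<sigma>\<in>S. frag_of (cap_coeff m (u \<sigma>) (v \<sigma>) (w \<sigma>) (s \<sigma>), y \<sigma>)) +
        frag_of (cap_coeff m (u \<sigma>) (v \<sigma>) (w \<sigma>) (s \<sigma>), y \<sigma>))) \<in> cap_graph N M P f i a l b j"
    using insert.prems
    by (simp add: chain_space_def chain_tens_def tens_def[of type_ring] CM.T_add CPM.T_add f cap_coeff_def)
  ultimately show ?case using insert.hyps by (simp add: add.commute)
qed

text \<open>
  The sign is an element of \<open>k\<close> on the left and a multiple in the abelian group on the right.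
\<close>

lemma sign_tens:
  assumes "z \<in> carrier PM"
  shows "frag_of (z, of_int (sign \<sigma>) * y) - frag_cmul (sign \<sigma>) (frag_of (z, y)) \<in> CPM.null"
proof (cases \<sigma> rule: sign_cases)
  case odd
  have "frag_of (z, 0) - (frag_of (z, y) + frag_of (z, - y)) \<in> CPM.null"
    using CPM.null_add_right[of z y "- y"] assms by simp
  from CPM.null_diff[OF CPM.null_zero_right this, of z] assms odd show ?thesis
    by (simp add: add.commute)
qed (simp add: CPM.null_zero)

text \<open>
  The shuffle decomposition is a presentation of the chain of the kind used to define the cap product,
  since the two antisymmetrised blocks lie in \<open>W\<^sub>a\<close> and \<open>W\<^sub>b\<close>.  The sign is attached to the block that
  stays in the chain.
\<close>

lemma cap_term_shuffle:
  fixes h :: "nat \<Rightarrow> 'b"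
  assumes f: "\<And>w. w \<in> W N b \<Longrightarrow> f w = F w" and m: "m \<in> carrier M" and n: "n = i + a + l + b + j"
  defines "X \<equiv> \<lambda>\<sigma> s t. wterm (map (\<lambda>k. h (\<sigma> k)) [s..<t]) 1"
  shows "cap_term N M P f i a l b j (CM.cls (frag_of (m, Ant n (wterm (map h [0..<n]) 1)))) =
    CPM.cls (\<Sum>\<sigma> \<in> Sh n i a b j. frag_cmul (sign \<sigma>) (frag_of
      (cap_coeff m (X \<sigma> 0 i) (X \<sigma> (i + a) (n - b - j)) (Ant b (X \<sigma> (n - b - j) (n - j))) (X \<sigma> (n - j) n),
       Ant a (X \<sigma> i (i + a)))))"
proof (rule cap_term_eq[OF _ f])
  let ?z = "\<lambda>\<sigma>. cap_coeff m (X \<sigma> 0 i) (X \<sigma> (i + a) (n - b - j)) (Ant b (X \<sigma> (n - b - j) (n - j))) (X \<sigma> (n - j) n)"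
  let ?y = "\<lambda>\<sigma>. of_int (sign \<sigma>) * Ant a (X \<sigma> i (i + a))"
  have fin: "finite (Sh n i a b j)"
    by (rule finite_subset[OF _ finite_permutations[OF finite_lessThan[of n]]]) (auto simp: Sh_def)
  have "of_int (sign \<sigma>) * Ant a (X \<sigma> i (i + a)) = Ant a (of_int (sign \<sigma>) * X \<sigma> i (i + a))" for \<sigma>
    using Ant_scal[of "X \<sigma> i (i + a)" a "of_int (sign \<sigma>)"]
    by (simp add: X_def tens_pow_wterm of_int_wterm scal_wterm)
  then have y: "?y \<sigma> \<in> W N a" for \<sigma>
    by (simp add: Ant_in_W X_def of_int_wterm wterm_mult tens_pow_wterm)
  have "(CM.cls (frag_of (m, \<Sum>\<sigma> \<in> Sh n i a b j. X \<sigma> 0 i * ?y \<sigma> * X \<sigma> (i + a) (n - b - j) *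
      Ant b (X \<sigma> (n - b - j) (n - j)) * X \<sigma> (n - j) n)),
    CPM.cls (\<Sum>\<sigma> \<in> Sh n i a b j. frag_of (?z \<sigma>, ?y \<sigma>))) \<in> cap_graph N M P f i a l b j"
    by (rule cap_graph_sum[OF f m fin]) (use n y in \<open>auto simp: X_def intro!: tens_pow_wterm Ant_in_W\<close>)
  moreover have "CPM.cls (\<Sum>\<sigma> \<in> Sh n i a b j. frag_of (?z \<sigma>, ?y \<sigma>)) =
    CPM.cls (\<Sum>\<sigma> \<in> Sh n i a b j. frag_cmul (sign \<sigma>) (frag_of (?z \<sigma>, Ant a (X \<sigma> i (i + a)))))"
    unfolding CPM.cls_eq_iff sum_subtractf[symmetric]
    by (intro CPM.null_sum sign_tens cap_coeff_closed[OF m])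
  ultimately show "(CM.cls (frag_of (m, Ant n (wterm (map h [0..<n]) 1))),
    CPM.cls (\<Sum>\<sigma> \<in> Sh n i a b j. frag_cmul (sign \<sigma>) (frag_of (?z \<sigma>, Ant a (X \<sigma> i (i + a))))))
    \<in> cap_graph N M P f i a l b j"
    unfolding Ant_shuffle[OF n, of h] X_def by simp
qed

end

theorem mainTheorem4:
  fixes scl :: "'k::field \<Rightarrow> 'v::ab_group_add \<Rightarrow> 'v"
    and e :: "'b::{finite,linorder} \<Rightarrow> 'v"
    and N p q :: nat
    and M :: "(('b, 'k) tensor set, 'm) bimod"
    and P :: "(('b, 'k) tensor set, 'p) bimod"
    and f :: "('b, 'k) tensor set \<Rightarrow> 'p"
    and m :: 'm and bs :: "'b list" and x :: "nat \<Rightarrow> 'v"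
  assumes "vector_space scl" and "ordered_basis scl e" and "2 \<le> CARD('b)"
    and "2 \<le> N" and "N \<le> CARD('b)"
    and "sym_bimodule N M" and "sym_bimodule N P"
    and "p \<le> q" and "nu N (q - p) \<noteq> nu N q - nu N p"
    and "klinear (ext_pow (nu N p)) (over_k N P) f"
    and "m \<in> carrier M"
    and "length bs = nu N q" and "sorted_wrt (<) bs"
    and "\<And>k. k < nu N q \<Longrightarrow> x k = e (bs ! k)"
  defines "PM \<equiv> tensor_prod (sym_alg N) P M"
    and "a \<equiv> nu N (q - p)" and "b \<equiv> nu N p" and "n \<equiv> nu N q"
  defines "C \<equiv> ext_chains N PM a"
    and "X \<equiv> \<lambda>\<sigma> from to. map (\<lambda>k. x (\<sigma> k)) [from..<to]"
  shows "koszul_cap N M P p q (cochain_of_ext b f)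
           (chain_of_ext N M n (ext_tens N M n m (wedge scl e (map x [0..<n])))) =
         chain_of_ext N PM a
           (\<ominus>\<^bsub>C\<^esub> finsum C (\<lambda>(i, j). \<Oplus>\<^bsub>C\<^esub>\<sigma> \<in> Sh n i a b j.
              add_pow C (sign \<sigma>)
                (ext_tens N PM a
                  (tens (sym_alg N) P M
                    (smult P (sym_proj N (vprod scl e (X \<sigma> (a + i) (n - b - j))))
                      (f (wedge scl e (X \<sigma> (n - b - j) (n - j)))))
                    (rsmult M
                      (smult M (sym_proj N (vprod scl e (X \<sigma> (n - j) n))) m)
                      (sym_proj N (vprod scl e (X \<sigma> 0 i)))))
                  (wedge scl e (X \<sigma> i (a + i)))))
            {(i, j). i + j \<le> N - 2})"
proof -
  have parity: "odd p \<and> even q"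
  proof (rule ccontr)
    assume "\<not> (odd p \<and> even q)"
    then consider p' where "p = 2 * p'" | p' q' where "p = 2 * p' + 1" "q = 2 * q' + 1"
      by (metis evenE oddE)
    then have "nu N (q - p) = nu N q - nu N p"
    proof cases
      case 1
      then obtain r where "q = 2 * p' + r" using assms(8) le_Suc_ex by blast
      with 1 show ?thesis by (auto simp: nu_def distrib_left)
    next
      case 2
      then have "q - p = 2 * (q' - p')" by simp
      then have "nu N (q - p) = N * (q' - p')" by (simp add: nu_def)
      also have "\<dots> = nu N q - nu N p" using 2 by (simp add: nu_def diff_mult_distrib2)
      finally show ?thesis .
    qed
    with assms(9) show False by blast
  qed
  \<comment> \<open>the degrees of the five pieces add up: \<open>\<nu>(q) = \<nu>(q - p) + \<nu>(p) + (N - 2)\<close>\<close>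
  then obtain p' q' where pq: "p = 2 * p' + 1" "q = 2 * q'" by (metis evenE oddE)
  then have lt: "p' < q'" using assms(8) by simp
  then have "q - p = 2 * (q' - p' - 1) + 1" using pq by simp
  then have ab: "a = N * (q' - p' - 1) + 1" "b = N * p' + 1" "n = N * q'"
    using pq by (simp_all add: a_def b_def n_def nu_def)
  obtain r where r: "q' = p' + 1 + r" using lt less_imp_Suc_add by fastforce
  have n: "n = a + b + (N - 2)" using assms(4) by (simp add: ab r algebra_simps)
  have small: "N \<le> b \<or> b \<le> 1" by (cases p') (auto simp: ab)

  \<comment> \<open>the linear extension of the cochain; it agrees with it on \<open>W\<^sub>b\<close> because \<open>b = 1\<close> or \<open>b > N\<close>\<close>
  define F where "F w = f (ext_proj (increasing_part b w))" for w
  have f_lin: "f \<in> carrier (ext_pow b) \<rightarrow> carrier P"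
    "\<And>Y Y'. Y \<in> carrier (ext_pow b) \<Longrightarrow> Y' \<in> carrier (ext_pow b) \<Longrightarrow>
      f (Y \<oplus>\<^bsub>ext_alg\<^esub> Y') = f Y \<oplus>\<^bsub>P\<^esub> f Y'"
    "\<And>c Y. Y \<in> carrier (ext_pow b) \<Longrightarrow> f (ext_proj (scal c) \<otimes>\<^bsub>ext_alg\<^esub> Y) = lact N P (scal c) (f Y)"
    using assms(10) by (auto simp: klinear_def b_def)
  interpret M: sym_bim N M by unfold_locales fact
  interpret P: sym_bim N P by unfold_locales fact
  interpret cap_data N M P F
  proof
    fix w w' :: "('b, 'k) tensor" and c :: 'k
    have ext: "ext_proj (increasing_part b w) \<in> carrier (ext_pow b)" for w :: "('b, 'k) tensor"
      by (simp add: increasing_part_tens_pow)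
    show "F w \<in> carrier P" using f_lin(1) ext[of w] by (auto simp: F_def)
    show "F (w + w') = F w \<oplus>\<^bsub>P\<^esub> F w'"
      using f_lin(2)[OF ext[of w] ext[of w']] by (simp add: F_def increasing_part_add ext_proj_add)
    show "F (scal c * w) = lact N P (scal c) (F w)"
      using f_lin(3)[OF ext[of w]] by (simp add: F_def increasing_part_scal ext_proj_mult)
  qed
  interpret CE: balanced_pair type_ring "over_k N PM" "ext_pow a :: ('k, ('b, 'k) tensor set) bimod"
    unfolding PM_def by (rule balanced_pair_ext_pow) (auto intro: PM.T_abelian_group rsmult_PM_closed)
  have cochain: "cochain_of_ext b f w = F w" if "w \<in> W N b" for w
    using cochain_of_ext_eq[OF assms(4) small that] by (simp add: F_def)
  have F_Ant: "F (Ant b w) = f (ext_proj w)" if "w \<in> tens_pow b" for w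
    using ext_proj_increasing_part_Ant[OF that] by (simp add: F_def)

  define Y where "Y \<sigma> s t = wterm (map (\<lambda>k. bs ! \<sigma> k) [s..<t]) (1 :: 'k)" for \<sigma> s t
  have vprod_X: "vprod scl e (X \<sigma> s t) = Y \<sigma> s t" if "\<sigma> permutes {..<n}" "t \<le> n" for \<sigma> s t
  proof -
    have "X \<sigma> s t = map e (map (\<lambda>k. bs ! \<sigma> k) [s..<t])"
      using that permutes_in_image[OF that(1)] assms(14) by (auto simp: X_def n_def)
    then show ?thesis by (simp only: vprod_basis[OF assms(1,2)] Y_def)
  qed
  have "map x [0..<n] = map e (map ((!) bs) [0..<n])" using assms(14) by (simp add: n_def)
  then have wedge_x: "wedge scl e (map x [0..<n]) = ext_proj (wterm (map ((!) bs) [0..<n]) 1)"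
    by (simp only: wedge_def vprod_basis[OF assms(1,2)])
  define z where "z = CM.cls (frag_of (m, Ant n (wterm (map ((!) bs) [0..<n]) 1)))"
  have z: "chain_of_ext N M n (ext_tens N M n m (wedge scl e (map x [0..<n]))) = z"
    unfolding ext_tens_def tens_def z_def wedge_x
    by (subst chain_of_ext_class) (auto intro: M.bim.abelian_group M.ract_closed simp: ext_phi_ext_proj tens_pow_wterm)

  define D where "D = {(i, j). i + j \<le> N - 2}"
  have finD: "finite D"
    by (rule finite_subset[of _ "{..N - 2} \<times> {..N - 2}"]) (auto simp: D_def)
  \<comment> \<open>the two sides differ only in the last factor: \<open>Ant\<^sub>a\<close> of a word in \<open>L\<close>, its wedge product in \<open>R\<close>\<close>
  define t where "t = (\<lambda>(i, j) \<sigma>. tens (sym_alg N) P M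
    (lact N P (Y \<sigma> (a + i) (n - b - j)) (f (ext_proj (Y \<sigma> (n - b - j) (n - j)))))
    (ract N M (lact N M (Y \<sigma> (n - j) n) m) (Y \<sigma> 0 i)))"
  have tZ: "t (i, j) \<sigma> = cap_coeff m (Y \<sigma> 0 i) (Y \<sigma> (a + i) (n - b - j)) (Ant b (Y \<sigma> (n - b - j) (n - j))) (Y \<sigma> (n - j) n)"
    if "(i, j) \<in> D" for i j \<sigma>
    using that n by (simp add: t_def cap_coeff_def F_Ant Y_def tens_pow_wterm D_def)
  have t_closed: "t (i, j) \<sigma> \<in> carrier PM" if "(i, j) \<in> D" for i j \<sigma>
    using cap_coeff_closed[OF assms(11)] by (simp add: tZ[OF that] PM_def)
  define L where "L = (\<lambda>(i, j). \<Sum>\<sigma> \<in> Sh n i a b j.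
    frag_cmul (sign \<sigma>) (frag_of (t (i, j) \<sigma>, Ant a (Y \<sigma> i (a + i)))))"
  define R where "R = (\<lambda>(i, j). \<Sum>\<sigma> \<in> Sh n i a b j.
    frag_cmul (sign \<sigma>) (frag_of (t (i, j) \<sigma>, ext_proj (Y \<sigma> i (a + i)))))"
  have fin_Sh: "finite (Sh n i a b j)" for i j
    by (rule finite_subset[OF _ finite_permutations[OF finite_lessThan[of n]]]) (auto simp: Sh_def)

  have cap: "cap_term N M P (cochain_of_ext b f) i a (N - 2 - i - j) b j z = CPM.cls (L (i, j))"
    if "(i, j) \<in> D" for i j
  proof -
    interpret S: cap_split N M P F i a "N - 2 - i - j" b j ..
    have "n = i + a + (N - 2 - i - j) + b + j" using that n by (simp add: D_def)
    from S.cap_term_shuffle[OF cochain assms(11) this, of "(!) bs"]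
    show ?thesis by (simp add: z_def L_def tZ[OF that] add.commute[of a i] flip: Y_def)
  qed
  have L_frags: "L ij \<in> CPM.frags" if "ij \<in> D" for ij
    using that t_closed
    by (auto simp: L_def PM_def CPM.frags_def keys_frag_of keys_cmul_iff
        split: prod.splits dest!: subsetD[OF keys_sum])
  have lhs: "koszul_cap N M P p q (cochain_of_ext b f) z = CPM.cls (- (\<Sum>ij\<in>D. L ij))"
  proof -
    have "finsum CPM.T (\<lambda>(i, j). cap_term N M P (cochain_of_ext b f) i a (N - 2 - i - j) b j z) D =
        (\<Oplus>\<^bsub>CPM.T\<^esub>ij\<in>D. CPM.cls (L ij))"
      using CPM.T_abelian_group L_frags cap
      by (intro abelian_monoid.finsum_cong' abelian_group.axioms(1)) (auto simp: CPM.T_carrier)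
    also have "\<dots> = CPM.cls (\<Sum>ij\<in>D. L ij)" by (rule CPM.T_finsum[OF finD L_frags])
    finally show ?thesis
      using parity CPM.T_uminus[OF CPM.frags_sum[of D L, OF L_frags]]
      by (simp add: koszul_cap_def Let_def chain_space_def a_def b_def D_def)
  qed

  have C: "C = CE.T" by (simp add: C_def ext_chains_def)
  interpret C: abelian_group C unfolding C by (rule CE.T_abelian_group)
  define summand where "summand i j \<sigma> = add_pow C (sign \<sigma>)
      (ext_tens N PM a
        (tens (sym_alg N) P M
          (smult P (sym_proj N (vprod scl e (X \<sigma> (a + i) (n - b - j))))
            (f (wedge scl e (X \<sigma> (n - b - j) (n - j)))))
          (rsmult M
            (smult M (sym_proj N (vprod scl e (X \<sigma> (n - j) n))) m)
            (sym_proj N (vprod scl e (X \<sigma> 0 i)))))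
        (wedge scl e (X \<sigma> i (a + i))))" for i j \<sigma>
  have term_frags: "frag_cmul (sign \<sigma>) (frag_of (t (i, j) \<sigma>, ext_proj (Y \<sigma> i (a + i)))) \<in> CE.frags"
    "frag_of (t (i, j) \<sigma>, ext_proj (Y \<sigma> i (a + i))) \<in> CE.frags" if "(i, j) \<in> D" for i j \<sigma>
    using t_closed[OF that] by (simp_all add: CE.frags_def keys_frag_of Y_def tens_pow_wterm
        subset_iff)
  have summand: "summand i j \<sigma> = CE.cls (frag_cmul (sign \<sigma>) (frag_of (t (i, j) \<sigma>, ext_proj (Y \<sigma> i (a + i)))))"
    if "(i, j) \<in> D" "\<sigma> \<in> Sh n i a b j" for i j \<sigma>
  proof -
    have \<sigma>: "\<sigma> permutes {..<n}" using that(2) by (simp add: Sh_def)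
    have len: "a + i \<le> n" "n - b - j \<le> n" "n - j \<le> n" "i \<le> n" using that(1) n by (simp_all add: D_def)
    have "ext_tens N PM a
        (tens (sym_alg N) P M
          (smult P (sym_proj N (vprod scl e (X \<sigma> (a + i) (n - b - j))))
            (f (wedge scl e (X \<sigma> (n - b - j) (n - j)))))
          (rsmult M
            (smult M (sym_proj N (vprod scl e (X \<sigma> (n - j) n))) m)
            (sym_proj N (vprod scl e (X \<sigma> 0 i)))))
        (wedge scl e (X \<sigma> i (a + i))) = CE.cls (frag_of (t (i, j) \<sigma>, ext_proj (Y \<sigma> i (a + i))))"
      using len by (simp add: ext_tens_def tens_def[of type_ring] wedge_def vprod_X[OF \<sigma>] t_def)
    then show ?thesis
      unfolding summand_def C
      using CE.T_add_pow_sign[OF term_frags(2)[OF that(1)], of "sign \<sigma>"] sign_cases[of \<sigma>] by auto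
  qed
  have "(\<Oplus>\<^bsub>C\<^esub>\<sigma> \<in> Sh n i a b j. summand i j \<sigma>) = CE.cls (R (i, j))" if ij: "(i, j) \<in> D" for i j
  proof -
    have "(\<Oplus>\<^bsub>C\<^esub>\<sigma> \<in> Sh n i a b j. summand i j \<sigma>) = (\<Oplus>\<^bsub>C\<^esub>\<sigma> \<in> Sh n i a b j.
        CE.cls (frag_cmul (sign \<sigma>) (frag_of (t (i, j) \<sigma>, ext_proj (Y \<sigma> i (a + i))))))"
      using summand[OF ij] term_frags(1)[OF ij]
      by (intro C.finsum_cong') (auto simp: C CE.T_carrier)
    also have "\<dots> = CE.cls (R (i, j))"
      unfolding C R_def prod.case by (rule CE.T_finsum[OF fin_Sh term_frags(1)[OF ij]])
    finally show ?thesis .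
  qed
  moreover have R_frags: "R ij \<in> CE.frags" if "ij \<in> D" for ij
    using that term_frags(1) by (cases ij) (auto simp: R_def intro: CE.frags_sum)
  ultimately have "finsum C (\<lambda>(i, j). \<Oplus>\<^bsub>C\<^esub>\<sigma> \<in> Sh n i a b j. summand i j \<sigma>) D = (\<Oplus>\<^bsub>C\<^esub>ij \<in> D. CE.cls (R ij))"
    by (intro C.finsum_cong') (auto simp: C CE.T_carrier)
  also have "\<dots> = CE.cls (\<Sum>ij\<in>D. R ij)" unfolding C by (rule CE.T_finsum[OF finD R_frags])
  finally have "\<ominus>\<^bsub>C\<^esub> finsum C (\<lambda>(i, j). \<Oplus>\<^bsub>C\<^esub>\<sigma> \<in> Sh n i a b j. summand i j \<sigma>) D =
      CE.cls (- (\<Sum>ij\<in>D. R ij))"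
    using CE.T_uminus[OF CE.frags_sum[of D R, OF R_frags]] by (simp add: C)
  moreover have "chain_of_ext N PM a (CE.cls (- (\<Sum>ij\<in>D. R ij))) = CPM.cls (- (\<Sum>ij\<in>D. L ij))"
  proof -
    have "frag_extend (\<lambda>(x, Y). frag_of (x, ext_phi a Y)) (R ij) = L ij" for ij
      by (cases ij) (simp add: R_def L_def frag_extend_sum[OF fin_Sh] frag_extend_cmul comp_def
          ext_phi_ext_proj Y_def tens_pow_wterm)
    then have "frag_extend (\<lambda>(x, Y). frag_of (x, ext_phi a Y)) (- (\<Sum>ij\<in>D. R ij)) = - (\<Sum>ij\<in>D. L ij)"
      by (simp add: frag_extend_minus frag_extend_sum[OF finD] comp_def)
    then show ?thesis
      unfolding PM_def by (subst chain_of_ext_class) (auto intro: PM.T_abelian_group rsmult_PM_closed)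
  qed
  ultimately show ?thesis unfolding z lhs summand_def D_def[symmetric] by simp
qed

end
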